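(* Let $E$ be an arbitrary directed graph, $K$ a field, and $L=L_K(E)$ the Leavitt path algebra of $E$ over $K$. Every non-graded two-sided ideal $I$ of $L$ satisfies $I^m\neq I^n$ for all integers $0<m<n$. Moreover, each power $I^n$ ($n\ge 1$) is a non-graded ideal.
   Context: A directed graph $E=(E^0,E^1,r,s)$ consists of sets $E^0$ (vertices) and $E^1$ (edges), of arbitrary cardinality, with maps $r,s:E^1\to E^0$ (range, source). A vertex $v$ is regular if $s^{-1}(v)$ is finite and non-empty. The Leavitt path algebra $L_K(E)$ is the (not necessarily unital) $K$-algebra generated by pairwise orthogonal idempotents $\{v:v\in E^0\}$ and elements $\{e,e^*:e\in E^1\}$ subject to: (1) $s(e)e=e=er(e)$; (2) $r(e)e^*=e^*=e^*s(e)$; (3) $e^*e=r(e)$ and $e^*f=0$ for edges $e\ne f$; (4) $v=\sum_{s(e)=v}ee^*$ for every regular vertex $v$. It is $\mathbb{Z}$-graded, $L=\bigoplus_n L_n$, by $\deg v=0$, $\deg e=1$, $\deg e^*=-1$; an ideal $I$ is graded if $I=\bigoplus_n(I\cap L_n)$, and non-graded otherwise. *)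

theory Defs
  imports
    "HOL-Algebra.QuotRing"
    "HOL-Algebra.Ideal_Product"
    "HOL-Algebra.Module"
    "HOL-Library.Poly_Mapping"
    "Graph_Theory.Digraph"
begin

section \<open>Not necessarily unital algebras\<close>

text \<open>
  A not necessarily unital algebra is a record of HOL-Algebra type \<open>module\<close>
  whose \<open>one\<close> field is left \<open>undefined\<close> and never used.  The library locale \<open>ideal\<close> cannot be
  used for these, since it assumes a unital ring.
\<close>

definition two_sided_ideal :: "('a, 'm) ring_scheme \<Rightarrow> 'a set \<Rightarrow> bool" where
  "two_sided_ideal R I \<longleftrightarrow>
     additive_subgroup I R \<and>
     (\<forall>x\<in>carrier R. \<forall>a\<in>I. x \<otimes>\<^bsub>R\<^esub> a \<in> I \<and> a \<otimes>\<^bsub>R\<^esub> x \<in> I)"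

text \<open>
  Only meant for \<open>n \<ge> 1\<close>: \<open>I\<^sup>1 = I\<close> and \<open>I\<^sup>n\<^sup>+\<^sup>1 = I \<cdot> I\<^sup>n\<close>, where the library's \<open>ideal_prod\<close> consists of
  the finite sums of products (its definition does not refer to a unit).
\<close>

definition ideal_power :: "('a, 'm) ring_scheme \<Rightarrow> 'a set \<Rightarrow> nat \<Rightarrow> 'a set" where
  "ideal_power R I n = (ideal_prod R I ^^ (n - 1)) I"

text \<open>\<open>I = \<Oplus>\<^sub>n (I \<inter> D n)\<close>, for a grading \<open>D\<close> of \<open>R\<close>.\<close>

definition graded_ideal :: "('a, 'm) ring_scheme \<Rightarrow> (int \<Rightarrow> 'a set) \<Rightarrow> 'a set \<Rightarrow> bool" where
  "graded_ideal R D I \<longleftrightarrow>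
     two_sided_ideal R I \<and>
     (\<forall>a\<in>I. \<exists>!x. (\<forall>n. x n \<in> I \<inter> D n) \<and> finite {n. x n \<noteq> \<zero>\<^bsub>R\<^esub>} \<and>
                 a = (\<Oplus>\<^bsub>R\<^esub>n\<in>{n. x n \<noteq> \<zero>\<^bsub>R\<^esub>}. x n))"


section \<open>Free algebras\<close>

text \<open>
  The free monoid on \<open>'a\<close>, written additively: with this instance, the library's multiplication on
  \<open>'a word \<Rightarrow>\<^sub>0 'k\<close> is that of the free unital algebra on \<open>'a\<close>.
\<close>

datatype 'a word = Word (letters: "'a list")

instantiation word :: (type) monoid_add
begin

definition "0 = Word []"
definition "u + w = Word (letters u @ letters w)"

instance
  by standard (simp_all add: zero_word_def plus_word_def)

end

text \<open>
  The free non-unital algebra on \<open>X\<close>: combinations of the non-empty words in \<open>X\<close>.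
  Multiplication by \<open>single 0 c\<close> is multiplication by the scalar \<open>c\<close>.
\<close>

definition free_algebra :: "'a set \<Rightarrow> ('k::field, 'a word \<Rightarrow>\<^sub>0 'k) module" where
  "free_algebra X =
     \<lparr> carrier = {p. \<forall>w \<in> Poly_Mapping.keys p. w \<noteq> 0 \<and> set (letters w) \<subseteq> X},
       mult = (*), one = undefined, zero = 0, add = (+),
       smult = (\<lambda>c p. Poly_Mapping.single 0 c * p) \<rparr>"

definition gen :: "'a \<Rightarrow> 'a word \<Rightarrow>\<^sub>0 'k::field" where
  "gen x = Poly_Mapping.single (Word [x]) 1"

text \<open>Without a unit, closure under scalars has to be required separately.\<close>

definition generated_ideal :: "('k, 'a, 'm) module_scheme \<Rightarrow> 'a set \<Rightarrow> 'a set" where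
  "generated_ideal A S =
     \<Inter>{J. two_sided_ideal A J \<and> (\<forall>c. \<forall>a\<in>J. c \<odot>\<^bsub>A\<^esub> a \<in> J) \<and> S \<subseteq> J}"

definition quotient_algebra :: "('k, 'a, 'm) module_scheme \<Rightarrow> 'a set \<Rightarrow> ('k, 'a set) module" where
  "quotient_algebra A J =
     \<lparr> carrier = a_rcosets\<^bsub>A\<^esub> J, mult = rcoset_mult A J, one = undefined, zero = J,
       add = set_add A, smult = (\<lambda>c X. \<Union>a\<in>X. J +>\<^bsub>A\<^esub> (c \<odot>\<^bsub>A\<^esub> a)) \<rparr>"


section \<open>Leavitt path algebras\<close>

text \<open>
  A directed graph is a \<open>wf_digraph\<close>: vertices \<open>verts E\<close> and edges \<open>arcs E\<close> are arbitrary sets,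
  the source map is \<open>tail E\<close>, the range map is \<open>head E\<close>, and \<open>out_arcs E v\<close> is the set of edges
  with source \<open>v\<close>.
\<close>

datatype ('v, 'e) lpa_gen = Vertex 'v | Edge 'e | Ghost 'e

type_synonym ('v, 'e, 'k) lpa_free = "('v, 'e) lpa_gen word \<Rightarrow>\<^sub>0 'k"

definition regular_vertex :: "('v, 'e) pre_digraph \<Rightarrow> 'v \<Rightarrow> bool" where
  "regular_vertex E v \<longleftrightarrow> v \<in> verts E \<and> finite (out_arcs E v) \<and> out_arcs E v \<noteq> {}"

definition lpa_gens :: "('v, 'e) pre_digraph \<Rightarrow> ('v, 'e) lpa_gen set" where
  "lpa_gens E = Vertex ` verts E \<union> Edge ` arcs E \<union> Ghost ` arcs E"

text \<open>The defining relations \<open>a = b\<close>, as elements \<open>a - b\<close> of the free algebra.\<close>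

inductive_set lpa_relators :: "('v, 'e) pre_digraph \<Rightarrow> ('v, 'e, 'k::field) lpa_free set"
  for E :: "('v, 'e) pre_digraph" where
  idempotent: "v \<in> verts E \<Longrightarrow>
    gen (Vertex v) * gen (Vertex v) - gen (Vertex v) \<in> lpa_relators E"
| orthogonal: "v \<in> verts E \<Longrightarrow> w \<in> verts E \<Longrightarrow> v \<noteq> w \<Longrightarrow>
    gen (Vertex v) * gen (Vertex w) \<in> lpa_relators E"
| source_edge: "e \<in> arcs E \<Longrightarrow>
    gen (Vertex (tail E e)) * gen (Edge e) - gen (Edge e) \<in> lpa_relators E"
| edge_range: "e \<in> arcs E \<Longrightarrow>
    gen (Edge e) * gen (Vertex (head E e)) - gen (Edge e) \<in> lpa_relators E"
| range_ghost: "e \<in> arcs E \<Longrightarrow>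
    gen (Vertex (head E e)) * gen (Ghost e) - gen (Ghost e) \<in> lpa_relators E"
| ghost_source: "e \<in> arcs E \<Longrightarrow>
    gen (Ghost e) * gen (Vertex (tail E e)) - gen (Ghost e) \<in> lpa_relators E"
| ghost_edge: "e \<in> arcs E \<Longrightarrow>
    gen (Ghost e) * gen (Edge e) - gen (Vertex (head E e)) \<in> lpa_relators E"
| ghost_edge_distinct: "e \<in> arcs E \<Longrightarrow> f \<in> arcs E \<Longrightarrow> e \<noteq> f \<Longrightarrow>
    gen (Ghost e) * gen (Edge f) \<in> lpa_relators E"
| regular: "regular_vertex E v \<Longrightarrow>
    gen (Vertex v) - (\<Sum>e\<in>out_arcs E v. gen (Edge e) * gen (Ghost e)) \<in> lpa_relators E"

definition lpa_ideal :: "('v, 'e) pre_digraph \<Rightarrow> ('v, 'e, 'k::field) lpa_free set" where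
  "lpa_ideal E = generated_ideal (free_algebra (lpa_gens E)) (lpa_relators E)"

text \<open>
  The Leavitt path algebra of \<open>E\<close> over the field \<open>'k\<close>.  Each of its elements \<open>a\<close> satisfies
  \<open>a = u a = a u\<close> for some finite sum \<open>u\<close> of vertices, so that its ring ideals, in the sense of
  \<^const>\<open>two_sided_ideal\<close>, are automatically closed under scalars.
\<close>

definition leavitt_path_algebra ::
    "('v, 'e) pre_digraph \<Rightarrow> ('k::field, ('v, 'e, 'k) lpa_free set) module" where
  "leavitt_path_algebra E = quotient_algebra (free_algebra (lpa_gens E)) (lpa_ideal E)"

fun gen_degree :: "('v, 'e) lpa_gen \<Rightarrow> int" where
  "gen_degree (Vertex v) = 0"
| "gen_degree (Edge e) = 1"
| "gen_degree (Ghost e) = -1"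

definition word_degree :: "('v, 'e) lpa_gen word \<Rightarrow> int" where
  "word_degree w = sum_list (map gen_degree (letters w))"

definition lpa_component ::
    "('v, 'e) pre_digraph \<Rightarrow> int \<Rightarrow> ('v, 'e, 'k::field) lpa_free set set" where
  "lpa_component E n =
     {lpa_ideal E +>\<^bsub>free_algebra (lpa_gens E)\<^esub> p | p.
        p \<in> carrier (free_algebra (lpa_gens E)) \<and>
        (\<forall>w \<in> Poly_Mapping.keys p. word_degree w = n)}"

definition non_graded_ideal ::
    "('v, 'e) pre_digraph \<Rightarrow> ('v, 'e, 'k::field) lpa_free set set \<Rightarrow> bool" where
  "non_graded_ideal E I \<longleftrightarrow>
     two_sided_ideal (leavitt_path_algebra E) I \<and>
     \<not> graded_ideal (leavitt_path_algebra E) (lpa_component E) I"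

end

theory Submission
  imports Defs "Graph_Theory.Arc_Walk"
begin

text \<open>
  The only property of \<open>L = L\<^sub>K(E)\<close> that matters is that it is graded von Neumann regular: every
  homogeneous \<open>a\<close> satisfies \<open>a = a x a\<close> for some homogeneous \<open>x\<close>.

  If \<open>I\<^sup>n\<close> is graded then so is \<open>I\<close>: for the top component \<open>t = t x t\<close> of \<open>a \<in> I\<close>, the top component of
  \<open>(a x)\<^sup>n\<^sup>-\<^sup>1 a \<in> I\<^sup>n\<close> is \<open>(t x)\<^sup>n\<^sup>-\<^sup>1 t = t\<close>, so \<open>t \<in> I\<close>.

  If \<open>I\<^sup>m = I\<^sup>n\<close> with \<open>m < n\<close> then \<open>J = I\<^sup>m\<close> satisfies \<open>J = J\<^sup>2\<close>, and such a \<open>J\<close> is graded.  Otherwise let \<open>G\<close> be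
  the largest graded ideal inside \<open>J\<close>, and let \<open>a \<in> J - G\<close> have the least possible number of
  consecutive degrees.  Multiplying \<open>a\<close> by homogeneous elements gives \<open>c \<in> J\<close> whose top component is
  an idempotent \<open>e \<notin> G\<close> of degree 0, with \<open>c = e c = c e\<close> modulo \<open>G\<close>.  Division by \<open>c\<close> gives
  \<open>e J \<subseteq> c L + G\<close>, and comparison of top components shows that \<open>c\<close> cancels from the left on \<open>e L\<close>
  modulo \<open>G\<close>.  As \<open>c \<in> e J J \<subseteq> c J + G\<close>, cancelling \<open>c\<close> yields \<open>e \<in> J\<close>, a contradiction.

  For the regularity, a homogeneous element is a combination of products \<open>p q\<^sup>*\<close> with \<open>|p| - |q|\<close> fixed.
  If \<open>a - a y a\<close> is regular then so is \<open>a\<close>.  With this step one removes first the terms with shorter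
  paths, by induction on the length, which leaves terms with \<open>|p|\<close> and \<open>|q|\<close> fixed.  These multiply like
  matrix units, and the step removes one row of a matrix at a time.
\<close>

section \<open>Graded rings with quasi-inverses of homogeneous elements\<close>

text \<open>Ideals are taken relative to a subset \<open>F\<close> of a type of class
  \<open>ring\<close>. The carrier of the free algebra is such a subset, so type-class arithmetic
  like \<open>algebra_simps\<close> stays available in all computations.\<close>

definition ideal_of :: "'a::ring set \<Rightarrow> 'a set \<Rightarrow> bool" where
  "ideal_of F J \<longleftrightarrow> J \<subseteq> F \<and> 0 \<in> J \<and> (\<forall>a\<in>J. \<forall>b\<in>J. a - b \<in> J) \<and>
     (\<forall>x\<in>F. \<forall>a\<in>J. x * a \<in> J \<and> a * x \<in> J)"

lemma ideal_ofD:
  assumes "ideal_of F J"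
  shows ideal_of_subset: "a \<in> J \<Longrightarrow> a \<in> F"
    and ideal_of_zero: "0 \<in> J"
    and ideal_of_diff: "a \<in> J \<Longrightarrow> b \<in> J \<Longrightarrow> a - b \<in> J"
    and ideal_of_uminus: "a \<in> J \<Longrightarrow> - a \<in> J"
    and ideal_of_add: "a \<in> J \<Longrightarrow> b \<in> J \<Longrightarrow> a + b \<in> J"
    and ideal_of_mult_left: "x \<in> F \<Longrightarrow> a \<in> J \<Longrightarrow> x * a \<in> J"
    and ideal_of_mult_right: "x \<in> F \<Longrightarrow> a \<in> J \<Longrightarrow> a * x \<in> J"
proof -
  show *: "0 \<in> J" "\<And>a b. a \<in> J \<Longrightarrow> b \<in> J \<Longrightarrow> a - b \<in> J"
    using assms by (auto simp: ideal_of_def)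
  then show **: "a \<in> J \<Longrightarrow> - a \<in> J" for a
    by (metis diff_0)
  show "a \<in> J \<Longrightarrow> b \<in> J \<Longrightarrow> a + b \<in> J"
    using *(2)[of a "- b"] ** by simp
qed (use assms in \<open>auto simp: ideal_of_def\<close>)

lemma ideal_of_sum:
  assumes "ideal_of F J" "\<And>i. i \<in> A \<Longrightarrow> f i \<in> J"
  shows "sum f A \<in> J"
  using assms(2)
  by (induction A rule: infinite_finite_induct)
    (auto intro: ideal_of_zero[OF assms(1)] ideal_of_add[OF assms(1)])

text \<open>For \<open>N\<close> contained in \<open>A\<close> and \<open>B\<close>, this is the preimage of the product of \<open>A/N\<close> and \<open>B/N\<close>.\<close>

inductive_set prod_mod :: "'a::ring set \<Rightarrow> 'a set \<Rightarrow> 'a set \<Rightarrow> 'a set"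
  for N A B where
    base: "a \<in> N \<Longrightarrow> a \<in> prod_mod N A B"
  | prod: "a \<in> A \<Longrightarrow> b \<in> B \<Longrightarrow> a * b \<in> prod_mod N A B"
  | add: "a \<in> prod_mod N A B \<Longrightarrow> b \<in> prod_mod N A B \<Longrightarrow> a + b \<in> prod_mod N A B"

lemma prod_mod_mono: "A \<subseteq> A' \<Longrightarrow> B \<subseteq> B' \<Longrightarrow> prod_mod N A B \<subseteq> prod_mod N A' B'"
proof
  fix x assume "x \<in> prod_mod N A B" "A \<subseteq> A'" "B \<subseteq> B'"
  then show "x \<in> prod_mod N A' B'"
    by (induction rule: prod_mod.induct) (auto intro: prod_mod.intros)
qed

text \<open>\<open>cmp n a\<close> is the component of degree \<open>n\<close>. It is total on the
  type, and only closure is relative to \<open>F\<close>. The axiom \<open>cmp_mult\<close> has a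
  homogeneous left factor; the convolution formula \<open>cmp_mult_sum\<close> follows by
  summation.\<close>

locale graded_ring =
  fixes F :: "'a::ring set" and cmp :: "int \<Rightarrow> 'a \<Rightarrow> 'a"
  assumes ideal_F: "ideal_of F F"
    and cmp_F: "a \<in> F \<Longrightarrow> cmp n a \<in> F"
    and cmp_add: "cmp n (a + b) = cmp n a + cmp n b"
    and finite_cmp: "finite {n. cmp n a \<noteq> 0}"
    and sum_cmp: "(\<Sum>n | cmp n a \<noteq> 0. cmp n a) = a"
    and cmp_cmp: "cmp m (cmp n a) = (if m = n then cmp n a else 0)"
    and cmp_mult: "cmp n (cmp m a * b) = cmp m a * cmp (n - m) b"
begin

lemma cmp_zero [simp]: "cmp n 0 = 0"
  using cmp_add[of n 0 0] by simp

lemma cmp_uminus: "cmp n (- a) = - cmp n a"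
  using cmp_add[of n a "- a"] by (simp add: eq_neg_iff_add_eq_0 add.commute)

lemma cmp_diff: "cmp n (a - b) = cmp n a - cmp n b"
  using cmp_add[of n a "- b"] by (simp add: cmp_uminus)

lemma cmp_sum: "cmp n (sum f A) = (\<Sum>i\<in>A. cmp n (f i))"
  by (induction A rule: infinite_finite_induct) (auto simp: cmp_add)

lemma cmp_mult_sum: "cmp n (a * b) = (\<Sum>m | cmp m a \<noteq> 0. cmp m a * cmp (n - m) b)"
proof -
  have "cmp n (a * b) = cmp n ((\<Sum>m | cmp m a \<noteq> 0. cmp m a) * b)"
    by (simp add: sum_cmp)
  also have "\<dots> = (\<Sum>m | cmp m a \<noteq> 0. cmp m a * cmp (n - m) b)"
    unfolding sum_distrib_right cmp_sum cmp_mult ..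
  finally show ?thesis .
qed

lemma in_if_cmp: "ideal_of F J \<Longrightarrow> (\<And>n. cmp n a \<in> J) \<Longrightarrow> a \<in> J"
  using ideal_of_sum[of F J "{n. cmp n a \<noteq> 0}" "\<lambda>n. cmp n a"] by (simp add: sum_cmp)

text \<open>A window of \<open>w\<close> consecutive degrees starting at \<open>l\<close>. It need
  not be tight: for width \<open>Suc w\<close> the top component, in degree
  \<open>l + int w\<close>, may vanish. Inductions on \<open>w\<close> therefore never need exact
  degrees.\<close>

definition supported :: "int \<Rightarrow> nat \<Rightarrow> 'a \<Rightarrow> bool" where
  "supported l w a \<longleftrightarrow> (\<forall>n. cmp n a \<noteq> 0 \<longrightarrow> l \<le> n \<and> n < l + int w)"

lemma supported_exists: "\<exists>l w. supported l w a"
proof (cases "{n. cmp n a \<noteq> 0} = {}")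
  case False
  let ?S = "{n. cmp n a \<noteq> 0}"
  have "supported (Min ?S) (nat (Max ?S - Min ?S + 1)) a"
    unfolding supported_def using False finite_cmp[of a]
    by (smt (verit) Max_ge Min_le mem_Collect_eq nat_0_le)
  then show ?thesis by blast
qed (auto simp: supported_def)

lemma supported_0: "supported l 0 a \<Longrightarrow> a = 0"
  using sum_cmp[of a] by (simp add: supported_def linorder_not_less[symmetric])

lemma supported_cmp: "supported n 1 (cmp n a)"
  by (auto simp: supported_def cmp_cmp split: if_splits)

lemma supported_diff_top:
  assumes "supported l (Suc w) a" "supported l (Suc w) b" "cmp (l + int w) a = cmp (l + int w) b"
  shows "supported l w (a - b)"
  unfolding supported_def
proof (intro allI impI)
  fix n assume n: "cmp n (a - b) \<noteq> 0"
  then have "cmp n a \<noteq> 0 \<or> cmp n b \<noteq> 0" "n \<noteq> l + int w"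
    using assms(3) by (auto simp: cmp_diff)
  then show "l \<le> n \<and> n < l + int w"
    using assms(1,2) by (fastforce simp: supported_def)
qed

lemma supported_mono: "supported l w a \<Longrightarrow> l' \<le> l \<Longrightarrow> l + int w \<le> l' + int w' \<Longrightarrow> supported l' w' a"
  by (fastforce simp: supported_def)

lemma supported_top: "supported l (Suc w) (cmp (l + int w) a)"
  by (rule supported_mono[OF supported_cmp]) auto

text \<open>The windows end in degrees \<open>l + int v\<close> and \<open>k + int w\<close>. The
  sum of these two degrees is reached only by the product of the two top components.\<close>

lemma
  assumes "supported l (Suc v) a" "supported k (Suc w) b"
  shows supported_mult: "supported (l + k) (Suc (v + w)) (a * b)"
    and cmp_mult_top: "cmp (l + k + int (v + w)) (a * b) = cmp (l + int v) a * cmp (k + int w) b"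
proof -
  have outside: "cmp i a * cmp (n - i) b = 0" if "n < l + k \<or> l + k + int (v + w) < n" for n i
  proof (cases "cmp i a = 0")
    case False
    then have "l \<le> i" "i \<le> l + int v"
      using assms(1) by (auto simp: supported_def)
    then have "\<not> (k \<le> n - i \<and> n - i < k + int (Suc w))"
      using that by auto
    then have "cmp (n - i) b = 0"
      using assms(2) by (auto simp: supported_def)
    then show ?thesis
      by simp
  qed auto
  have "cmp n (a * b) = 0" if "n < l + k \<or> l + k + int (v + w) < n" for n
    unfolding cmp_mult_sum by (rule sum.neutral) (use outside[OF that] in auto)
  then show "supported (l + k) (Suc (v + w)) (a * b)"
    unfolding supported_def by force
  let ?n = "l + k + int (v + w)"
  have zero: "cmp i a * cmp (?n - i) b = 0" if "i \<noteq> l + int v" for i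
  proof (cases "cmp i a = 0")
    case False
    then have "i < l + int v"
      using assms(1) that by (fastforce simp: supported_def)
    then have "\<not> ?n - i < k + int (Suc w)"
      by auto
    then have "cmp (?n - i) b = 0"
      using assms(2) unfolding supported_def by blast
    then show ?thesis
      by simp
  qed auto
  have "cmp ?n (a * b) = (\<Sum>i | cmp i a \<noteq> 0. if i = l + int v then cmp i a * cmp (?n - i) b else 0)"
    unfolding cmp_mult_sum by (rule sum.cong) (use zero in auto)
  also have "\<dots> = cmp (l + int v) a * cmp (?n - (l + int v)) b"
    using finite_cmp[of a] by (simp add: sum.delta)
  also have "?n - (l + int v) = k + int w"
    by simp
  finally show "cmp ?n (a * b) = cmp (l + int v) a * cmp (k + int w) b" .
qed

lemma supported_mult_homogeneous:
  assumes "supported l (Suc v) a" "cmp k b = b"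
  shows "supported (l + k) (Suc v) (a * b)" "cmp (l + k + int v) (a * b) = cmp (l + int v) a * b"
    "supported (k + l) (Suc v) (b * a)" "cmp (l + k + int v) (b * a) = b * cmp (l + int v) a"
proof -
  have b: "supported k (Suc 0) b"
    using supported_cmp[of k b] assms(2) by simp
  show "supported (l + k) (Suc v) (a * b)" "cmp (l + k + int v) (a * b) = cmp (l + int v) a * b"
    using supported_mult[OF assms(1) b] cmp_mult_top[OF assms(1) b] assms(2) by auto
  show "supported (k + l) (Suc v) (b * a)" "cmp (l + k + int v) (b * a) = b * cmp (l + int v) a"
    using supported_mult[OF b assms(1)] cmp_mult_top[OF b assms(1)] assms(2)
    by (auto simp: add_ac)
qed

lemma homogeneous_mult: "cmp m a = a \<Longrightarrow> cmp n b = b \<Longrightarrow> cmp (m + n) (a * b) = a * b"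
  using cmp_mult[of "m + n" m a b] by simp

text \<open>For an ideal \<open>J\<close> this is the largest graded ideal inside \<open>J\<close>.
  Gradedness of \<open>J\<close> is expressed below as
  \<open>J \<subseteq> graded_part J\<close>.\<close>

definition graded_part :: "'a set \<Rightarrow> 'a set" where
  "graded_part J = {a. \<forall>n. cmp n a \<in> J}"

lemma graded_part_subset: "ideal_of F J \<Longrightarrow> graded_part J \<subseteq> J"
  unfolding graded_part_def using in_if_cmp by auto

lemma ideal_graded_part:
  assumes J: "ideal_of F J"
  shows "ideal_of F (graded_part J)"
  unfolding ideal_of_def
proof (intro conjI ballI)
  note JD = ideal_ofD[OF J]
  show sub: "graded_part J \<subseteq> F"
    using graded_part_subset[OF J] JD(1) by blast
  show "0 \<in> graded_part J"
    using JD(2) by (simp add: graded_part_def)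
  show "a - b \<in> graded_part J" if "a \<in> graded_part J" "b \<in> graded_part J" for a b
    using that by (simp add: graded_part_def cmp_diff JD(3))
  fix x a assume x: "x \<in> F" and a: "a \<in> graded_part J"
  then have "a \<in> F"
    using sub by auto
  then have "cmp n (x * a) \<in> J" "cmp n (a * x) \<in> J" for n
    unfolding cmp_mult_sum
    using x a by (auto intro!: ideal_of_sum[OF J] intro: JD(6,7) cmp_F simp: graded_part_def)
  then show "x * a \<in> graded_part J" "a * x \<in> graded_part J"
    by (auto simp: graded_part_def)
qed

lemma homogeneous_in_graded_part:
  assumes "ideal_of F J" "cmp n a = a" "a \<in> J"
  shows "a \<in> graded_part J"
proof -
  have "cmp m a = (if m = n then a else 0)" for m
    using cmp_cmp[of m n a] assms(2) by simp
  then show ?thesis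
    using assms ideal_of_zero[of F J] by (simp add: graded_part_def)
qed

end

text \<open>The ring under study is \<open>F\<close> modulo the graded ideal \<open>N\<close>;
  equations in it are written as membership of differences in \<open>N\<close>. The quasi-inverse in
  \<open>regular\<close> is not assumed to be homogeneous.\<close>

locale graded_quotient = graded_ring +
  fixes N
  assumes ideal_N: "ideal_of F N"
    and cmp_N: "a \<in> N \<Longrightarrow> cmp n a \<in> N"
    and regular: "a \<in> F \<Longrightarrow> cmp n a = a \<Longrightarrow> \<exists>x\<in>F. a - a * x * a \<in> N"
begin

text \<open>In degree \<open>n\<close> only the component of \<open>x\<close> of degree
  \<open>- n\<close> contributes to \<open>a * x * a\<close>. As \<open>N\<close> contains the
  components of its elements, \<open>x\<close> may be replaced by that component.\<close>

lemma homogeneous_quasi_inverse: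
  assumes "a \<in> F" "cmp n a = a"
  obtains x where "x \<in> F" "cmp (- n) x = x" "a - a * x * a \<in> N"
proof -
  obtain x where x: "x \<in> F" "a - a * x * a \<in> N"
    using regular[OF assms] by blast
  obtain l w where lw: "supported l w x"
    using supported_exists by blast
  have cmp_a: "cmp m a = (if m = n then a else 0)" for m
    using cmp_cmp[of m n a] assms(2) by simp
  have "cmp n (a * (x * a)) = a * cmp 0 (x * a)"
    using cmp_mult[of n n a "x * a"] assms(2) by simp
  moreover have "cmp 0 (x * a) = cmp (- n) x * a"
  proof -
    have "cmp 0 (x * a) = (\<Sum>m | cmp m x \<noteq> 0. if m = - n then cmp m x * a else 0)"
      unfolding cmp_mult_sum
      by (rule sum.cong) (auto simp: cmp_a)
    also have "\<dots> = cmp (- n) x * a"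
      using finite_cmp[of x] by (simp add: sum.delta)
    finally show ?thesis .
  qed
  ultimately have "cmp n (a - a * x * a) = a - a * cmp (- n) x * a"
    using assms(2) by (simp add: cmp_diff mult.assoc)
  with cmp_N[OF x(2), of n] have "a - a * cmp (- n) x * a \<in> N"
    by simp
  with that[of "cmp (- n) x"] x(1) show ?thesis
    by (simp add: cmp_F cmp_cmp)
qed

text \<open>Modulo \<open>N\<close> the hypothesis \<open>idem\<close> says \<open>K = K K\<close>.
  If \<open>K\<close> is not graded, an element outside \<open>?G\<close> with the narrowest window
  gives a \<open>c\<close> in \<open>K\<close> by which one can divide and which can be cancelled;
  this forces its leading idempotent into \<open>K\<close>.\<close>

lemma idempotent_imp_graded:
  assumes K: "ideal_of F K" and NK: "N \<subseteq> K" and idem: "K \<subseteq> prod_mod N K K"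
  shows "K \<subseteq> graded_part K"
proof (rule ccontr)
  let ?G = "graded_part K"
  note G = ideal_graded_part[OF K]
  note KD = ideal_ofD[OF K] and GD = ideal_ofD[OF G] and FD = ideal_ofD[OF ideal_F]
  have NG: "N \<subseteq> ?G"
    using NK cmp_N by (auto simp: graded_part_def)
  have GK: "?G \<subseteq> K"
    by (rule graded_part_subset[OF K])
  \<comment> \<open>The width to be minimised. Width 0 means \<open>a = 0\<close>, which lies in
    \<open>?G\<close>, so the least width has the form \<open>Suc n\<close>, and every element of
    \<open>K\<close> of width at most \<open>n\<close> is in \<open>?G\<close>.\<close>
  define P where "P w \<longleftrightarrow> (\<exists>l a. a \<in> K \<and> a \<notin> ?G \<and> supported l w a)" for w
  assume "\<not> K \<subseteq> ?G"
  then have "\<exists>w. P w"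
    unfolding P_def using supported_exists by blast
  then have Pw: "P (LEAST w. P w)"
    by (rule LeastI_ex)
  obtain n where n: "(LEAST w. P w) = Suc n"
    using Pw supported_0 GD(2) by (cases "LEAST w. P w") (auto simp: P_def)
  have minimal: "b \<in> ?G" if "b \<in> K" "supported l v b" "v \<le> n" for b l v
    using not_less_Least[of v P] that n by (auto simp: P_def)
  obtain l a where a: "a \<in> K" "a \<notin> ?G" "supported l (Suc n) a"
    using Pw[unfolded n] unfolding P_def by blast
  define t where "t = cmp (l + int n) a"
  have tF: "t \<in> F"
    unfolding t_def using a(1) KD(1) cmp_F by blast
  have t_hom: "cmp (l + int n) t = t"
    by (simp add: t_def cmp_cmp)
  \<comment> \<open>Otherwise \<open>a - t\<close> would be an element of \<open>K\<close> of width
    \<open>n\<close>, hence in \<open>?G\<close> by minimality, and \<open>a\<close> would be in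
    \<open>?G\<close> along with \<open>t\<close>.\<close>
  have "t \<notin> K"
  proof
    assume "t \<in> K"
    then have "t \<in> ?G"
      by (rule homogeneous_in_graded_part[OF K t_hom])
    moreover have "a - t \<in> ?G"
    proof (rule minimal)
      show "a - t \<in> K"
        using a(1) \<open>t \<in> K\<close> by (rule KD(3))
      show "supported l n (a - t)"
        unfolding t_def by (rule supported_diff_top[OF a(3) supported_top]) (simp add: cmp_cmp)
    qed simp
    ultimately have "a - t + t \<in> ?G"
      by (intro GD(5))
    with a(2) show False
      by simp
  qed
  obtain x where x: "x \<in> F" "cmp (- (l + int n)) x = x" "t - t * x * t \<in> N"
    using homogeneous_quasi_inverse[OF tF t_hom] by blast
  \<comment> \<open>Modulo \<open>?G\<close> the element \<open>f\<close> is idempotent. The top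
    component of \<open>x * a\<close> is \<open>f\<close>, so that of \<open>c\<close> is
    \<open>f * f * f\<close>. Taking this cube as \<open>e\<close> makes the top component of
    \<open>c\<close> equal to \<open>e\<close> exactly, not only modulo \<open>?G\<close>.\<close>
  define f where "f = x * t"
  define c where "c = f * (x * a) * f"
  define e where "e = f * f * f"
  have f: "f \<in> F" "cmp 0 f = f"
    using FD(6)[OF x(1) tF] homogeneous_mult[OF x(2) t_hom] by (auto simp: f_def)
  have e: "e \<in> F" "cmp 0 e = e"
    using FD(6)[OF FD(6)[OF f(1) f(1)] f(1)]
      homogeneous_mult[OF homogeneous_mult[OF f(2) f(2)] f(2)] by (auto simp: e_def)
  have xaF: "x * a \<in> F"
    using FD(6) x(1) KD(1) a(1) by auto
  have cK: "c \<in> K"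
    unfolding c_def by (intro KD(6,7) f x a)
  then have cF: "c \<in> F"
    by (rule KD(1))
  \<comment> \<open>The window of \<open>c\<close> consists of the degrees from \<open>- n\<close>
    to 0, since \<open>x\<close> cancels the top degree of \<open>a\<close> and \<open>f\<close> has
    degree 0.\<close>
  have c_supported: "supported (- int n) (Suc n) c" and c_top: "cmp 0 c = e"
  proof -
    have 1: "supported (- int n) (Suc n) (x * a)" "cmp 0 (x * a) = f"
      using supported_mult_homogeneous(3,4)[OF a(3) x(2)] by (auto simp: f_def t_def)
    have 2: "supported (- int n) (Suc n) (f * (x * a))" "cmp 0 (f * (x * a)) = f * f"
      using supported_mult_homogeneous(3,4)[OF 1(1) f(2)] 1(2) by auto
    show "supported (- int n) (Suc n) c" "cmp 0 c = e"
      using supported_mult_homogeneous(1,2)[OF 2(1) f(2)] 2(2) by (auto simp: c_def e_def)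
  qed
  have ff: "f * f - f \<in> ?G"
  proof -
    have "f * f - f = - (x * (t - t * x * t))"
      by (simp add: f_def algebra_simps)
    then show ?thesis
      using GD(4)[OF GD(6)[OF x(1)]] x(3) NG by auto
  qed
  have fff: "f * f * f - f \<in> ?G"
    using GD(5)[OF GD(6)[OF f(1) ff] ff] by (simp add: algebra_simps)
  have ffff: "f * f * f * f - f \<in> ?G"
    using GD(5)[OF GD(6)[OF f(1) fff] ff] by (simp add: algebra_simps)
  have ee: "e * e - e \<in> ?G"
    using GD(3)[OF GD(5)[OF GD(6)[OF e(1) fff] ffff] fff]
    by (simp add: algebra_simps e_def)
  have ec: "e * c - c \<in> ?G"
    using GD(7)[OF f(1) GD(7)[OF xaF ffff]]
    by (simp add: algebra_simps e_def c_def)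
  have ce: "c * e - c \<in> ?G"
    using GD(6)[OF f(1) GD(6)[OF xaF ffff]]
    by (simp add: algebra_simps e_def c_def)
  \<comment> \<open>Division with remainder: \<open>e * b\<close> and \<open>c * s\<close> have the
    same top component, so their difference has a narrower window. The window of
    \<open>c * s\<close> fits into that of \<open>b\<close> as long as \<open>v \<ge> n\<close>; for
    narrower \<open>b\<close>, minimality already puts \<open>b\<close> into
    \<open>?G\<close>.\<close>
  have divide: "\<exists>r\<in>F. e * b - c * r \<in> ?G" if "b \<in> K" "supported k v b" for b k v
    using that
  proof (induction v arbitrary: b)
    case 0
    then show ?case
      using supported_0[of k b] FD(2) GD(2) by (auto intro!: bexI[of _ 0])
  next
    case (Suc v)
    show ?case
    proof (cases "Suc v \<le> n")
      case True
      then have "b \<in> ?G"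
        using minimal Suc.prems by blast
      then show ?thesis
        using GD(6)[OF e(1)] FD(2) by (auto intro!: bexI[of _ 0])
    next
      case False
      define s where "s = cmp (k + int v) b"
      have sF: "s \<in> F"
        unfolding s_def using Suc.prems(1) KD(1) cmp_F by blast
      have s: "cmp (k + int v) s = s"
        by (simp add: s_def cmp_cmp)
      have "e * b - c * s \<in> K"
        by (intro KD(3,6,7) e sF cK Suc.prems)
      moreover have "supported k v (e * b - c * s)"
      proof (rule supported_diff_top)
        show "supported k (Suc v) (e * b)"
          using supported_mult_homogeneous(3)[OF Suc.prems(2) e(2)] by simp
        show "supported k (Suc v) (c * s)"
          by (rule supported_mono[OF supported_mult_homogeneous(1)[OF c_supported s]]) (use False in auto)
        show "cmp (k + int v) (e * b) = cmp (k + int v) (c * s)"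
          using supported_mult_homogeneous(4)[OF Suc.prems(2) e(2)]
            supported_mult_homogeneous(2)[OF c_supported s] c_top by (simp add: s_def)
      qed
      ultimately obtain r where r: "r \<in> F" "e * (e * b - c * s) - c * r \<in> ?G"
        using Suc.IH by blast
      \<comment> \<open>The induction hypothesis multiplies the remainder by a second
        \<open>e\<close>. It is removed with \<open>e e = e\<close> and \<open>e c = c\<close>
        modulo \<open>?G\<close>.\<close>
      have "e * b - c * (s + r) = (e * (e * b - c * s) - c * r) - (e * e - e) * b + (e * c - c) * s"
        by (simp add: algebra_simps)
      also have "\<dots> \<in> ?G"
        by (intro GD(3,5,7) r ee ec sF KD(1) Suc.prems)
      finally show ?thesis
        using FD(5)[OF sF r(1)] by blast
    qed
  qed
  \<comment> \<open>The top component of \<open>c * y\<close> is \<open>e * s\<close>, and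
    \<open>?G\<close> contains components of its elements, so \<open>e * s\<close> is in
    \<open>?G\<close>. Since \<open>c e = c\<close> modulo \<open>?G\<close>, also
    \<open>c * s\<close> is in \<open>?G\<close>, and the induction continues with
    \<open>y - s\<close>.\<close>
  have cancel: "e * y \<in> ?G" if "y \<in> F" "supported k v y" "c * y \<in> ?G" for y k v
    using that
  proof (induction v arbitrary: y)
    case 0
    then show ?case
      using supported_0[of k y] GD(2) by auto
  next
    case (Suc v)
    define s where "s = cmp (k + int v) y"
    have sF: "s \<in> F"
      unfolding s_def using Suc.prems(1) cmp_F by blast
    have s: "cmp (k + int v) s = s"
      by (simp add: s_def cmp_cmp)
    have "cmp (k + int v) (c * y) = e * s"
      using cmp_mult_top[OF c_supported Suc.prems(2)] by (simp add: c_top s_def)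
    then have "e * s \<in> K"
      using Suc.prems(3) unfolding graded_part_def by (metis mem_Collect_eq)
    then have es: "e * s \<in> ?G"
      using homogeneous_in_graded_part[OF K] homogeneous_mult[OF e(2) s] by simp
    have "c * (y - s) = c * y - c * (e * s) + (c * e - c) * s"
      by (simp add: algebra_simps)
    also have "\<dots> \<in> ?G"
      by (intro GD(3,5) GD(7)[OF sF] GD(6)[OF cF] es ce Suc.prems)
    finally have "e * (y - s) \<in> ?G"
      by (intro Suc.IH FD(3) Suc.prems sF)
        (auto simp: s_def cmp_cmp intro: supported_diff_top[OF Suc.prems(2) supported_top])
    then have "e * (y - s) + e * s \<in> ?G"
      by (rule GD(5)[OF _ es])
    then show ?case
      by (simp add: algebra_simps)
  qed
  \<comment> \<open>On products \<open>y * z\<close> the quotient can be chosen in \<open>K\<close>: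
    dividing \<open>y\<close> by \<open>c\<close> gives some \<open>r\<close> in \<open>F\<close>,
    and \<open>r * z\<close> is in \<open>K\<close> because \<open>z\<close> is. By
    \<open>idem\<close> this applies to \<open>z = c\<close>.\<close>
  have "\<exists>b\<in>K. e * z - c * b \<in> ?G" if "z \<in> prod_mod N K K" for z
    using that
  proof (induction rule: prod_mod.induct)
    case (base z)
    then show ?case
      using GD(6)[OF e(1)] NG KD(2) by (intro bexI[of _ 0]) auto
  next
    case (prod y z)
    obtain r where r: "r \<in> F" "e * y - c * r \<in> ?G"
      using supported_exists divide[OF prod(1)] by blast
    have "e * (y * z) - c * (r * z) = (e * y - c * r) * z"
      by (simp add: algebra_simps)
    moreover have "\<dots> \<in> ?G"
      by (rule GD(7)[OF KD(1)[OF prod(2)] r(2)])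
    ultimately show ?case
      using KD(6)[OF r(1) prod(2)] by metis
  next
    case (add y z)
    then obtain b b' where b: "b \<in> K" "b' \<in> K" "e * y - c * b \<in> ?G" "e * z - c * b' \<in> ?G"
      by blast
    then have "b + b' \<in> K" "e * (y + z) - c * (b + b') \<in> ?G"
      using KD(5)[OF b(1,2)] GD(5)[OF b(3,4)] by (auto simp: algebra_simps)
    then show ?case
      by blast
  qed
  then obtain b where b: "b \<in> K" "e * c - c * b \<in> ?G"
    using idem cK by blast
  \<comment> \<open>Modulo \<open>?G\<close> one has \<open>c e = c = e c = c b\<close>. Cancelling
    \<open>c\<close> gives \<open>e = e b\<close>, so \<open>e\<close> is in \<open>K\<close>; then
    \<open>f\<close> and finally \<open>t\<close> are in \<open>K\<close>, against the choice of
    \<open>t\<close>.\<close>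
  have "c * (e - b) = (c * e - c) - (e * c - c) + (e * c - c * b)"
    by (simp add: algebra_simps)
  also have "\<dots> \<in> ?G"
    by (intro GD(3,5) ec ce b)
  finally have "e * (e - b) \<in> ?G"
    using cancel FD(3)[OF e(1) KD(1)[OF b(1)]] supported_exists by blast
  then have "e * (e - b) + e * b - (e * e - e) \<in> K"
    by (intro KD(3)[OF KD(5)]) (use GK ee KD(6)[OF e(1) b(1)] in blast)+
  then have "e \<in> K"
    by (simp add: algebra_simps)
  then have "e - (f * f * f - f) \<in> K"
    using KD(3) fff GK by blast
  then have "f \<in> K"
    by (simp add: e_def)
  then have "(t - t * x * t) + t * f \<in> K"
    using x(3) NK by (intro KD(5) KD(6)[OF tF]) auto
  with \<open>t \<notin> K\<close> show False
    by (simp add: f_def mult.assoc)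
qed

lemma ideal_prod_mod:
  assumes A: "ideal_of F A" and B: "ideal_of F B"
  shows "ideal_of F (prod_mod N A B)"
proof -
  note AD = ideal_ofD[OF A] and BD = ideal_ofD[OF B] and ND = ideal_ofD[OF ideal_N]
    and FD = ideal_ofD[OF ideal_F]
  have "z \<in> F \<and> - z \<in> prod_mod N A B \<and>
      (\<forall>x\<in>F. x * z \<in> prod_mod N A B \<and> z * x \<in> prod_mod N A B)" if "z \<in> prod_mod N A B" for z
    using that
  proof (induction rule: prod_mod.induct)
    case (base z)
    then show ?case
      by (auto intro: ND prod_mod.base)
  next
    case (prod a b)
    have "- (a * b) = (- a) * b" "\<And>x. x * (a * b) = (x * a) * b" "\<And>x. (a * b) * x = a * (b * x)"
      by (simp_all add: mult.assoc)
    then show ?case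
      using prod by (auto simp del: mult_minus_left intro!: prod_mod.prod intro: AD BD FD)
  next
    case (add y z)
    then show ?case
      using prod_mod.add[of "- y" N A B "- z"] by (auto simp: algebra_simps intro: prod_mod.add FD)
  qed
  moreover from this have "y - z \<in> prod_mod N A B" if "y \<in> prod_mod N A B" "z \<in> prod_mod N A B" for y z
    using prod_mod.add[of y N A B "- z"] that by auto
  ultimately show ?thesis
    unfolding ideal_of_def using prod_mod.base[OF ND(2)] by blast
qed

lemma prod_mod_subset:
  assumes "ideal_of F A" "ideal_of F B" "N \<subseteq> B"
  shows "prod_mod N A B \<subseteq> B"
proof
  fix z assume "z \<in> prod_mod N A B"
  then show "z \<in> B"
    using assms by (induction rule: prod_mod.induct) (auto intro: ideal_ofD)
qed

lemma prod_mod_assoc: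
  assumes A: "ideal_of F A"
  shows "prod_mod N A (prod_mod N B C) \<subseteq> prod_mod N (prod_mod N A B) C"
proof
  fix z assume "z \<in> prod_mod N A (prod_mod N B C)"
  then show "z \<in> prod_mod N (prod_mod N A B) C"
  proof (induction rule: prod_mod.induct)
    case (prod a z)
    from prod(2) show ?case
    proof (induction rule: prod_mod.induct)
      case (base b)
      then show ?case
        using prod(1) ideal_ofD(6)[OF ideal_N] ideal_ofD(1)[OF A] by (auto intro: prod_mod.base)
    next
      case (prod b c)
      then have "a * b * c \<in> prod_mod N (prod_mod N A B) C"
        using \<open>a \<in> A\<close> by (intro prod_mod.prod)
      then show ?case
        by (simp add: mult.assoc)
    next
      case (add y z)
      then show ?case
        using prod_mod.add by (auto simp: distrib_left)
    qed
  qed (auto intro: prod_mod.intros)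
qed

section \<open>Powers of an ideal \<open>J\<close>: \<open>(prod_mod N J ^^ k) J\<close> has
  exponent \<open>k + 1\<close>\<close>

context
  fixes J assumes J: "ideal_of F J" and NJ: "N \<subseteq> J"
begin

lemma ideal_funpow_prod_mod: "ideal_of F ((prod_mod N J ^^ k) J)"
  by (induction k) (auto intro: J ideal_prod_mod)

lemma subset_funpow_prod_mod: "N \<subseteq> (prod_mod N J ^^ k) J"
  using NJ by (cases k) (auto intro: prod_mod.base)

lemma funpow_prod_mod_antimono:
  assumes "m \<le> n"
  shows "(prod_mod N J ^^ n) J \<subseteq> (prod_mod N J ^^ m) J"
  using assms
proof (induction rule: dec_induct)
  case (step k)
  have "(prod_mod N J ^^ Suc k) J \<subseteq> (prod_mod N J ^^ k) J"
    using prod_mod_subset[OF J ideal_funpow_prod_mod subset_funpow_prod_mod] by simp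
  with step show ?case
    by blast
qed simp

text \<open>Induction on the window of \<open>a\<close>. Modulo \<open>N\<close> the top component
  \<open>t\<close> of \<open>a\<close> is also the top component of an element of the power. As the
  power is graded and contained in \<open>J\<close>, this puts \<open>t\<close> into
  \<open>J\<close>, and \<open>a - t\<close> has a narrower window.\<close>

lemma graded_funpow_prod_mod_imp_graded:
  assumes graded: "(prod_mod N J ^^ k) J \<subseteq> graded_part ((prod_mod N J ^^ k) J)"
  shows "J \<subseteq> graded_part J"
proof -
  note JD = ideal_ofD[OF J] and FD = ideal_ofD[OF ideal_F] and ND = ideal_ofD[OF ideal_N]
  have "a \<in> graded_part J" if "a \<in> J" "supported l v a" for a l v
    using that
  proof (induction v arbitrary: a)
    case 0
    then show ?case
      using supported_0[of l a] ideal_ofD(2)[OF ideal_graded_part[OF J]] by auto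
  next
    case (Suc v)
    define t where "t = cmp (l + int v) a"
    have tF: "t \<in> F"
      unfolding t_def using Suc.prems(1) JD(1) cmp_F by blast
    have t: "cmp (l + int v) t = t"
      by (simp add: t_def cmp_cmp)
    obtain x where x: "x \<in> F" "cmp (- (l + int v)) x = x" "t - t * x * t \<in> N"
      using homogeneous_quasi_inverse[OF tF t] by blast
    \<comment> \<open>The witness is \<open>b = (a x)^j a\<close>. Its window widens with
      \<open>j\<close>, but always ends in degree \<open>l + int v\<close>, because the top degree
      of \<open>a * x\<close> is 0.\<close>
    have "\<exists>b l' v'. b \<in> (prod_mod N J ^^ j) J \<and> supported l' (Suc v') b \<and> l' + int v' = l + int v \<and>
        t - cmp (l + int v) b \<in> N" for j
    proof (induction j)
      case 0
      show ?case
        by (rule exI[of _ a], rule exI[of _ l], rule exI[of _ v])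
          (use Suc.prems ND(2) in \<open>auto simp: t_def\<close>)
    next
      case (Suc j)
      then obtain b l' v' where b: "b \<in> (prod_mod N J ^^ j) J" "supported l' (Suc v') b"
        "l' + int v' = l + int v" "t - cmp (l + int v) b \<in> N"
        by blast
      have ax: "supported (- int v) (Suc v) (a * x)" "cmp 0 (a * x) = t * x"
        using supported_mult_homogeneous(1,2)[OF \<open>supported l (Suc v) a\<close> x(2)] by (auto simp: t_def)
      have "supported (- int v + l') (Suc (v + v')) (a * x * b)"
        by (rule supported_mult[OF ax(1) b(2)])
      moreover have "cmp (l + int v) (a * x * b) = t * x * cmp (l + int v) b"
        using cmp_mult_top[OF ax(1) b(2)] ax(2) b(3) by (simp add: algebra_simps)
      moreover have "t - t * x * cmp (l + int v) b \<in> N"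
      proof -
        have "t - t * x * cmp (l + int v) b = (t - t * x * t) + t * x * (t - cmp (l + int v) b)"
          by (simp add: algebra_simps)
        also have "\<dots> \<in> N"
          by (intro ND(5,6) FD(6) x tF b)
        finally show ?thesis .
      qed
      moreover have "a * x * b \<in> (prod_mod N J ^^ Suc j) J"
        using prod_mod.prod[OF JD(7)[OF x(1) \<open>a \<in> J\<close>] b(1)] by simp
      ultimately show ?case
        using b(3) by (intro exI[of _ "a * x * b"] exI[of _ "- int v + l'"] exI[of _ "v + v'"]) auto
    qed
    then obtain b where b: "b \<in> (prod_mod N J ^^ k) J" "t - cmp (l + int v) b \<in> N"
      by blast
    have "cmp (l + int v) b \<in> J"
      using b(1) graded funpow_prod_mod_antimono[of 0 k] by (auto simp: graded_part_def)
    then have "(t - cmp (l + int v) b) + cmp (l + int v) b \<in> J"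
      using b(2) NJ by (intro JD(5)) auto
    then have tJ: "t \<in> J"
      by simp
    have "a - t \<in> graded_part J"
      unfolding t_def
      by (intro Suc.IH JD(3) Suc.prems tJ[unfolded t_def] supported_diff_top[OF Suc.prems(2) supported_top])
        (simp add: cmp_cmp)
    moreover have "t \<in> graded_part J"
      by (rule homogeneous_in_graded_part[OF J t tJ])
    ultimately have "a - t + t \<in> graded_part J"
      by (rule ideal_ofD(5)[OF ideal_graded_part[OF J]])
    then show ?case
      by simp
  qed
  then show ?thesis
    using supported_exists by blast
qed

text \<open>For \<open>K = J^(m+1) = J^(n+1)\<close> the decreasing chain of powers gives
  \<open>K \<subseteq> J K\<close>. Iterating this yields \<open>K \<subseteq> K K\<close>, so
  \<open>K\<close> is graded, and hence so is \<open>J\<close>.\<close>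

lemma funpow_prod_mod_strict:
  assumes eq: "(prod_mod N J ^^ m) J = (prod_mod N J ^^ n) J" and "m < n"
  shows "J \<subseteq> graded_part J"
proof (rule graded_funpow_prod_mod_imp_graded, rule idempotent_imp_graded)
  let ?K = "(prod_mod N J ^^ m) J"
  show "ideal_of F ?K" "N \<subseteq> ?K"
    by (rule ideal_funpow_prod_mod subset_funpow_prod_mod)+
  have K: "?K \<subseteq> prod_mod N J ?K"
    using eq funpow_prod_mod_antimono[of "Suc m" n] \<open>m < n\<close> by simp
  \<comment> \<open>This is \<open>K \<subseteq> J^(i+1) K\<close>; the case \<open>i = m\<close> is
    the claim.\<close>
  have "?K \<subseteq> prod_mod N ((prod_mod N J ^^ i) J) ?K" for i
  proof (induction i)
    case 0
    then show ?case
      using K by simp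
  next
    case (Suc i)
    have "?K \<subseteq> prod_mod N J (prod_mod N ((prod_mod N J ^^ i) J) ?K)"
      using K prod_mod_mono[OF order.refl Suc] by (rule order.trans)
    also have "\<dots> \<subseteq> prod_mod N ((prod_mod N J ^^ Suc i) J) ?K"
      using prod_mod_assoc[OF J] by simp
    finally show ?case .
  qed
  then show "?K \<subseteq> prod_mod N ?K ?K" .
qed

end

end


section \<open>Quotients of free algebras\<close>

lemma abelian_group_free_algebra: "abelian_group (free_algebra X)"
proof (rule abelian_groupI)
  fix p q :: "'a word \<Rightarrow>\<^sub>0 'k::field"
  assume "p \<in> carrier (free_algebra X)" "q \<in> carrier (free_algebra X)"
  then show "p \<oplus>\<^bsub>free_algebra X\<^esub> q \<in> carrier (free_algebra X)"
    using keys_add[of p q] by (auto simp: free_algebra_def)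
  show "\<exists>r\<in>carrier (free_algebra X). r \<oplus>\<^bsub>free_algebra X\<^esub> p = \<zero>\<^bsub>free_algebra X\<^esub>"
    by (rule bexI[of _ "- p"]) (use \<open>p \<in> _\<close> in \<open>auto simp: free_algebra_def\<close>)
qed (auto simp: free_algebra_def algebra_simps)

lemma a_inv_free_algebra:
  assumes "p \<in> carrier (free_algebra X)"
  shows "inv\<^bsub>add_monoid (free_algebra X)\<^esub> p = - p"
proof -
  interpret abelian_group "free_algebra X" by (rule abelian_group_free_algebra)
  have "- p \<in> carrier (free_algebra X)" "- p \<oplus>\<^bsub>free_algebra X\<^esub> p = \<zero>\<^bsub>free_algebra X\<^esub>"
    using assms by (auto simp: free_algebra_def)
  then show ?thesis
    using minus_equality[of "- p" p] assms by (simp add: a_inv_def)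
qed

text \<open>Passage from ideals of the record to \<open>ideal_of\<close>. The operations of
  \<open>free_algebra X\<close> are those of the type, so only the group inverse has to be
  identified.\<close>

lemma two_sided_ideal_free_algebra_iff:
  "two_sided_ideal (free_algebra X) J \<longleftrightarrow> ideal_of (carrier (free_algebra X)) J"
proof
  assume J: "two_sided_ideal (free_algebra X) J"
  then interpret additive_subgroup J "free_algebra X"
    by (simp add: two_sided_ideal_def)
  have uminus: "- b \<in> J" if "b \<in> J" for b
    using subgroup.m_inv_closed[OF a_subgroup that] a_subset that a_inv_free_algebra[of b X] by auto
  have "a - b \<in> J" if "a \<in> J" "b \<in> J" for a b
    using a_closed[OF that(1) uminus[OF that(2)]] by (simp add: free_algebra_def)
  then show "ideal_of (carrier (free_algebra X)) J"
    using J a_subset zero_closed by (auto simp: ideal_of_def two_sided_ideal_def free_algebra_def)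
next
  assume J: "ideal_of (carrier (free_algebra X)) J"
  note JD = ideal_ofD[OF J]
  have "additive_subgroup J (free_algebra X)"
  proof (rule additive_subgroupI, rule subgroup.intro)
    show "inv\<^bsub>add_monoid (free_algebra X)\<^esub> p \<in> J" if "p \<in> J" for p
      using JD(1,4)[OF that] by (simp add: a_inv_free_algebra)
    show "J \<subseteq> carrier (add_monoid (free_algebra X))"
      using JD(1) by auto
  qed (use JD in \<open>auto simp: free_algebra_def\<close>)
  then show "two_sided_ideal (free_algebra X) J"
    using JD(6,7) by (simp add: two_sided_ideal_def) (simp add: free_algebra_def)
qed

lemma keys_word_mult:
  assumes "w \<in> Poly_Mapping.keys (p * q)"
  obtains u v where "u \<in> Poly_Mapping.keys p" "v \<in> Poly_Mapping.keys q" "w = u + v"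
  using assms keys_mult[of p q] by blast

lemma ideal_of_carrier_free_algebra: "ideal_of (carrier (free_algebra X)) (carrier (free_algebra X))"
  unfolding ideal_of_def
proof (intro conjI ballI)
  let ?F = "carrier (free_algebra X)"
  show "p - q \<in> ?F" if "p \<in> ?F" "q \<in> ?F" for p q
    using that keys_diff[of p q] by (auto simp: free_algebra_def)
  have "p * q \<in> ?F" if "p \<in> ?F" "q \<in> ?F" for p q
  proof -
    have "w \<noteq> 0 \<and> set (letters w) \<subseteq> X" if "w \<in> Poly_Mapping.keys (p * q)" for w
    proof -
      obtain u v where uv: "u \<in> Poly_Mapping.keys p" "v \<in> Poly_Mapping.keys q" "w = u + v"
        using \<open>w \<in> _\<close> by (rule keys_word_mult)
      then have "u \<noteq> 0" "set (letters u) \<subseteq> X" "set (letters v) \<subseteq> X"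
        using \<open>p \<in> ?F\<close> \<open>q \<in> ?F\<close> by (auto simp: free_algebra_def)
      then show ?thesis
        unfolding uv(3) by (cases u) (auto simp: zero_word_def plus_word_def)
    qed
    then show ?thesis
      by (simp add: free_algebra_def)
  qed
  then show "p * q \<in> ?F" "q * p \<in> ?F" if "p \<in> ?F" "q \<in> ?F" for p q
    using that by blast+
qed (auto simp: free_algebra_def)

section \<open>Cosets and the correspondence of ideals\<close>

locale free_algebra_quotient =
  fixes X :: "'a set" and N :: "('a word \<Rightarrow>\<^sub>0 'k::field) set"
  assumes N: "ideal_of (carrier (free_algebra X)) N"
begin

abbreviation F where "F \<equiv> carrier (free_algebra X)"
abbreviation Q where "Q \<equiv> quotient_algebra (free_algebra X) N"
abbreviation proj where "proj p \<equiv> N +>\<^bsub>free_algebra X\<^esub> p"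

lemmas FD = ideal_ofD[OF ideal_of_carrier_free_algebra[of X]]
lemmas ND = ideal_ofD[OF N]

lemma in_proj_iff: "q \<in> proj p \<longleftrightarrow> q - p \<in> N"
  by (force simp: a_r_coset_def r_coset_def free_algebra_def)

lemma proj_eq_iff: "proj p = proj q \<longleftrightarrow> p - q \<in> N"
proof
  assume "proj p = proj q"
  moreover have "p \<in> proj p"
    using ND(2) by (simp add: in_proj_iff)
  ultimately show "p - q \<in> N"
    by (simp add: in_proj_iff)
next
  assume pq: "p - q \<in> N"
  have "r - p \<in> N \<longleftrightarrow> r - q \<in> N" for r
    using ND(3)[of "r - q" "p - q"] ND(5)[of "r - p" "p - q"] pq by auto
  then show "proj p = proj q"
    by (auto simp: in_proj_iff)
qed

lemma carrier_quotient: "carrier Q = proj ` F"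
  by (auto simp: quotient_algebra_def A_RCOSETS_def RCOSETS_def a_r_coset_def)

lemma add_quotient: "proj p \<oplus>\<^bsub>Q\<^esub> proj q = proj (p + q)"
proof -
  have "(\<exists>a. a - p \<in> N \<and> (\<exists>b. b - q \<in> N \<and> r = a + b)) \<longleftrightarrow> r - (p + q) \<in> N" for r
  proof
    assume "\<exists>a. a - p \<in> N \<and> (\<exists>b. b - q \<in> N \<and> r = a + b)"
    then obtain a b where "a - p \<in> N" "b - q \<in> N" "r = a + b"
      by blast
    then show "r - (p + q) \<in> N"
      using ND(5)[of "a - p" "b - q"] by (simp add: algebra_simps)
  next
    assume "r - (p + q) \<in> N"
    then show "\<exists>a. a - p \<in> N \<and> (\<exists>b. b - q \<in> N \<and> r = a + b)"
      using ND(2) by (intro exI[of _ "r - q"] conjI exI[of _ q]) (auto simp: algebra_simps)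
  qed
  moreover have "set_add (free_algebra X) A B = {r. \<exists>a. a \<in> A \<and> (\<exists>b. b \<in> B \<and> r = a + b)}"
    for A B :: "('a word \<Rightarrow>\<^sub>0 'k) set"
    by (auto simp: set_add_def set_mult_def free_algebra_def)
  ultimately show ?thesis
    by (simp add: quotient_algebra_def in_proj_iff set_eq_iff)
qed

lemma zero_quotient: "\<zero>\<^bsub>Q\<^esub> = proj 0"
  by (auto simp: quotient_algebra_def in_proj_iff)

text \<open>\<open>rcoset_mult\<close> is a union of cosets over all choices of representatives.
  They coincide because \<open>N\<close> is an ideal.\<close>

lemma mult_quotient:
  assumes "p \<in> F" "q \<in> F"
  shows "proj p \<otimes>\<^bsub>Q\<^esub> proj q = proj (p * q)"
proof -
  have "proj (a * b) = proj (p * q)" if "a \<in> proj p" "b \<in> proj q" for a b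
  proof -
    have ab: "a - p \<in> N" "b - q \<in> N"
      using that by (auto simp: in_proj_iff)
    have "a \<in> F"
      using FD(5)[OF ND(1)[OF ab(1)] assms(1)] by simp
    have "a * b - p * q = a * (b - q) + (a - p) * q"
      by (simp add: algebra_simps)
    also have "\<dots> \<in> N"
      using \<open>a \<in> F\<close> assms by (intro ND(5,6,7) ab)
    finally show ?thesis
      by (simp add: proj_eq_iff)
  qed
  moreover have "p \<in> proj p" "q \<in> proj q"
    using ND(2) by (auto simp: in_proj_iff)
  moreover have "proj p \<otimes>\<^bsub>Q\<^esub> proj q = (\<Union>a\<in>proj p. \<Union>b\<in>proj q. proj (a * b))"
    by (simp add: quotient_algebra_def rcoset_mult_def free_algebra_def)
  ultimately show ?thesis
    by blast
qed

lemma abelian_group_quotient: "abelian_group Q"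
proof (rule abelian_groupI)
  fix a assume "a \<in> carrier Q"
  then obtain p where p: "p \<in> F" "a = proj p"
    by (auto simp: carrier_quotient)
  then show "\<exists>b\<in>carrier Q. b \<oplus>\<^bsub>Q\<^esub> a = \<zero>\<^bsub>Q\<^esub>"
    using FD(4)[OF p(1)] by (intro bexI[of _ "proj (- p)"]) (auto simp: carrier_quotient add_quotient zero_quotient)
qed (auto simp: carrier_quotient add_quotient zero_quotient algebra_simps FD)

lemma a_inv_quotient:
  assumes "p \<in> F"
  shows "inv\<^bsub>add_monoid Q\<^esub> (proj p) = proj (- p)"
proof -
  interpret abelian_group Q by (rule abelian_group_quotient)
  have "\<ominus>\<^bsub>Q\<^esub> proj p = proj (- p)"
    by (rule minus_equality) (use assms FD(4) in \<open>auto simp: carrier_quotient add_quotient zero_quotient\<close>)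
  then show ?thesis
    by (simp only: a_inv_def)
qed

definition preimage where "preimage I = {p \<in> F. proj p \<in> I}"

text \<open>With the next lemma this is the correspondence between the ideals of \<open>Q\<close>
  and the ideals of \<open>F\<close> that contain \<open>N\<close>. It moves the whole argument from
  the record \<open>Q\<close> to \<open>F\<close>.\<close>

lemma
  assumes I: "two_sided_ideal Q I"
  shows ideal_preimage: "ideal_of F (preimage I)"
    and subset_preimage: "N \<subseteq> preimage I"
    and image_preimage: "proj ` preimage I = I"
proof -
  interpret additive_subgroup I Q
    using I by (simp add: two_sided_ideal_def)
  have uminus: "proj (- p) \<in> I" if "p \<in> F" "proj p \<in> I" for p
    using subgroup.m_inv_closed[OF a_subgroup that(2)] that a_inv_quotient[of p] by auto
  show "ideal_of F (preimage I)"
    unfolding ideal_of_def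
  proof (intro conjI ballI)
    show "0 \<in> preimage I"
      using zero_closed FD(2) by (simp add: preimage_def zero_quotient)
    show "p - q \<in> preimage I" if "p \<in> preimage I" "q \<in> preimage I" for p q
      using that a_closed[of "proj p" "proj (- q)"] uminus[of q] FD(3)[of p q]
      by (auto simp: preimage_def add_quotient)
    show "p * q \<in> preimage I" "q * p \<in> preimage I" if "p \<in> F" "q \<in> preimage I" for p q
      using that I FD(6) by (auto simp: preimage_def two_sided_ideal_def carrier_quotient
          simp flip: mult_quotient)
  qed (auto simp: preimage_def)
  have "proj p = proj 0" if "p \<in> N" for p
    using that by (simp add: proj_eq_iff)
  then show "N \<subseteq> preimage I"
    using zero_closed ND(1) by (auto simp: preimage_def zero_quotient)
  show "proj ` preimage I = I"
    using a_subset by (auto simp: preimage_def carrier_quotient)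
qed

lemma
  assumes J: "ideal_of F J" and NJ: "N \<subseteq> J"
  shows two_sided_ideal_image: "two_sided_ideal Q (proj ` J)"
    and proj_in_image_iff: "proj p \<in> proj ` J \<longleftrightarrow> p \<in> J"
    and preimage_image: "preimage (proj ` J) = J"
proof -
  note JD = ideal_ofD[OF J]
  have "additive_subgroup (proj ` J) Q"
  proof (rule additive_subgroupI, rule subgroup.intro)
    show "inv\<^bsub>add_monoid Q\<^esub> a \<in> proj ` J" if "a \<in> proj ` J" for a
      using that JD(1,4) by (auto simp only: a_inv_quotient)
  qed (auto simp: carrier_quotient add_quotient zero_quotient intro!: imageI intro: JD)
  then show "two_sided_ideal Q (proj ` J)"
    using JD(1) by (auto simp: two_sided_ideal_def carrier_quotient mult_quotient intro!: imageI intro: JD(6,7))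
  show *: "proj p \<in> proj ` J \<longleftrightarrow> p \<in> J" for p
  proof
    assume "proj p \<in> proj ` J"
    then obtain q where q: "q \<in> J" "proj p = proj q"
      by blast
    then have "p - q \<in> J"
      using NJ by (auto simp: proj_eq_iff)
    then have "p - q + q \<in> J"
      using q(1) by (rule JD(5))
    then show "p \<in> J"
      by simp
  qed auto
  show "preimage (proj ` J) = J"
    using JD(1) by (auto simp: preimage_def *)
qed

lemma ideal_prod_image:
  assumes A: "ideal_of F A" and B: "ideal_of F B"
  shows "ideal_prod Q (proj ` A) (proj ` B) = proj ` prod_mod N A B"
proof (intro equalityI subsetI)
  note AD = ideal_ofD[OF A] and BD = ideal_ofD[OF B]
  fix z assume "z \<in> ideal_prod Q (proj ` A) (proj ` B)"
  then show "z \<in> proj ` prod_mod N A B"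
  proof (induction rule: ideal_prod.induct)
    case (prod i j)
    then show ?case
      using AD(1) BD(1) by (auto simp: mult_quotient intro: prod_mod.prod)
  next
    case (sum y z)
    then show ?case
      by (auto simp: add_quotient intro: prod_mod.add)
  qed
next
  note AD = ideal_ofD[OF A] and BD = ideal_ofD[OF B]
  have "proj p \<in> ideal_prod Q (proj ` A) (proj ` B)" if "p \<in> prod_mod N A B" for p
    using that
  proof (induction rule: prod_mod.induct)
    case (base p)
    then have "proj p = proj 0"
      by (simp add: proj_eq_iff)
    \<comment> \<open>The rules for \<open>ideal_prod\<close> have no clause for zero, so zero is
      obtained as a product of zeros.\<close>
    moreover have "proj 0 \<otimes>\<^bsub>Q\<^esub> proj 0 \<in> ideal_prod Q (proj ` A) (proj ` B)"
      by (intro ideal_prod.prod imageI AD(2) BD(2))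
    ultimately show ?case
      using mult_quotient[OF FD(2) FD(2)] by simp
  next
    case (prod a b)
    have "proj a \<otimes>\<^bsub>Q\<^esub> proj b \<in> ideal_prod Q (proj ` A) (proj ` B)"
      by (intro ideal_prod.prod imageI prod)
    then show ?case
      using AD(1) BD(1) prod by (simp add: mult_quotient)
  next
    case (add p q)
    then show ?case
      by (auto simp flip: add_quotient intro: ideal_prod.sum)
  qed
  then show "z \<in> ideal_prod Q (proj ` A) (proj ` B)" if "z \<in> proj ` prod_mod N A B" for z
    using that by blast
qed

lemma finsum_quotient:
  assumes "f \<in> A \<rightarrow> F"
  shows "finsum Q (\<lambda>i. proj (f i)) A = proj (sum f A)"
proof -
  interpret abelian_group Q by (rule abelian_group_quotient)
  show ?thesis
    using assms
  proof (induction A rule: infinite_finite_induct)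
    case (insert i A)
    then show ?case
      by (subst finsum_insert) (auto simp: carrier_quotient add_quotient)
  qed (auto simp: finsum_infinite zero_quotient)
qed

end

section \<open>The induced grading of the quotient\<close>

locale graded_free_algebra_quotient =
  free_algebra_quotient X N + graded_quotient "carrier (free_algebra X)" cmp N
  for X :: "'a set" and N :: "('a word \<Rightarrow>\<^sub>0 'k::field) set" and cmp
begin

definition component where "component n = proj ` {p \<in> F. cmp n p = p}"

text \<open>Uniqueness of homogeneous decompositions in \<open>Q\<close>: \<open>N\<close> contains
  the components of its elements, so representatives can be compared degree by degree.\<close>

lemma eq_proj_cmp:
  assumes x: "\<And>n. x n \<in> component n" and fin: "finite {n. x n \<noteq> \<zero>\<^bsub>Q\<^esub>}"
    and p: "proj p = finsum Q x {n. x n \<noteq> \<zero>\<^bsub>Q\<^esub>}"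
  shows "x n = proj (cmp n p)"
proof -
  let ?S = "{n. x n \<noteq> \<zero>\<^bsub>Q\<^esub>}"
  have "\<exists>q. q \<in> F \<and> cmp n q = q \<and> x n = proj q" for n
    using x[of n] by (auto simp: component_def)
  then obtain q where q: "\<And>n. q n \<in> F" "\<And>n. cmp n (q n) = q n" "x = (\<lambda>n. proj (q n))"
    by metis
  have "proj p = proj (sum q ?S)"
    unfolding p by (subst (1) q(3), rule finsum_quotient) (use q(1) in auto)
  then have "cmp n (p - sum q ?S) \<in> N"
    by (intro cmp_N) (simp add: proj_eq_iff)
  moreover have "cmp n (q m) = (if n = m then q n else 0)" for m
    using cmp_cmp[of n m "q m"] q(2)[of m] by simp
  ultimately have "cmp n p - (if n \<in> ?S then q n else 0) \<in> N"
    using fin by (simp add: cmp_diff cmp_sum)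
  then have "proj (cmp n p) = proj (if n \<in> ?S then q n else 0)"
    by (simp add: proj_eq_iff)
  also have "\<dots> = x n"
    using q(3) by (auto simp: zero_quotient)
  finally show ?thesis ..
qed

text \<open>By \<open>eq_proj_cmp\<close> the only possible decomposition of \<open>proj p\<close>
  consists of the cosets of the components of \<open>p\<close>.\<close>

lemma graded_ideal_image_iff:
  assumes J: "ideal_of F J" and NJ: "N \<subseteq> J"
  shows "graded_ideal Q component (proj ` J) \<longleftrightarrow> J \<subseteq> graded_part J"
proof
  assume graded: "graded_ideal Q component (proj ` J)"
  show "J \<subseteq> graded_part J"
  proof
    fix p assume p: "p \<in> J"
    have "\<exists>x. (\<forall>n. x n \<in> proj ` J \<inter> component n) \<and> finite {n. x n \<noteq> \<zero>\<^bsub>Q\<^esub>} \<and>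
        proj p = finsum Q x {n. x n \<noteq> \<zero>\<^bsub>Q\<^esub>}"
      using graded[unfolded graded_ideal_def, THEN conjunct2, THEN bspec, OF imageI[OF p]]
      by (rule ex1_implies_ex)
    then obtain x where x: "\<forall>n. x n \<in> proj ` J \<inter> component n" "finite {n. x n \<noteq> \<zero>\<^bsub>Q\<^esub>}"
      "proj p = finsum Q x {n. x n \<noteq> \<zero>\<^bsub>Q\<^esub>}"
      by (elim exE conjE)
    have "x n = proj (cmp n p)" for n
      by (rule eq_proj_cmp) (use x in auto)
    then have "proj (cmp n p) \<in> proj ` J" for n
      using x(1) by (metis IntD1)
    then show "p \<in> graded_part J"
      by (simp add: graded_part_def proj_in_image_iff[OF J NJ])
  qed
next
  assume graded: "J \<subseteq> graded_part J"
  have "\<exists>!x. (\<forall>n. x n \<in> proj ` J \<inter> component n) \<and> finite {n. x n \<noteq> \<zero>\<^bsub>Q\<^esub>} \<and>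
      proj p = finsum Q x {n. x n \<noteq> \<zero>\<^bsub>Q\<^esub>}" if p: "p \<in> J" for p
  proof (rule ex1I[of _ "\<lambda>n. proj (cmp n p)"])
    have pF: "p \<in> F"
      using ideal_ofD(1)[OF J p] .
    let ?S = "{n. proj (cmp n p) \<noteq> \<zero>\<^bsub>Q\<^esub>}"
    have S: "?S = {n. cmp n p \<notin> N}"
      by (simp add: zero_quotient proj_eq_iff)
    have sub: "?S \<subseteq> {n. cmp n p \<noteq> 0}"
      unfolding S using ND(2) by auto
    \<comment> \<open>Nonzero components of \<open>p\<close> that lie in \<open>N\<close> vanish in
      \<open>Q\<close>, so the index set shrinks to \<open>?S\<close>. The omitted components add up
      to an element of \<open>N\<close>.\<close>
    have "p - (\<Sum>n\<in>?S. cmp n p) = (\<Sum>n | cmp n p \<noteq> 0. cmp n p) - (\<Sum>n\<in>?S. cmp n p)"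
      by (simp only: sum_cmp)
    also have "\<dots> = (\<Sum>n\<in>{n. cmp n p \<noteq> 0} - ?S. cmp n p)"
      by (rule sum_diff[symmetric, OF finite_cmp sub])
    also have "\<dots> \<in> N"
      by (rule ideal_of_sum[OF N]) (simp add: S)
    finally have "proj p = proj (\<Sum>n\<in>?S. cmp n p)"
      by (simp add: proj_eq_iff)
    also have "\<dots> = finsum Q (\<lambda>n. proj (cmp n p)) ?S"
      by (rule finsum_quotient[symmetric]) (use cmp_F[OF pF] in auto)
    finally show "(\<forall>n. proj (cmp n p) \<in> proj ` J \<inter> component n) \<and> finite ?S \<and>
        proj p = finsum Q (\<lambda>n. proj (cmp n p)) ?S"
      using finite_subset[OF sub finite_cmp] graded p cmp_F[OF pF]
      by (auto simp: component_def graded_part_def cmp_cmp)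
  next
    fix x
    assume "(\<forall>n. x n \<in> proj ` J \<inter> component n) \<and> finite {n. x n \<noteq> \<zero>\<^bsub>Q\<^esub>} \<and>
      proj p = finsum Q x {n. x n \<noteq> \<zero>\<^bsub>Q\<^esub>}"
    then have "x n = proj (cmp n p)" for n
      by (intro eq_proj_cmp) auto
    then show "x = (\<lambda>n. proj (cmp n p))"
      by (rule ext)
  qed
  then show "graded_ideal Q component (proj ` J)"
    unfolding graded_ideal_def using two_sided_ideal_image[OF J NJ] by (simp only: simp_thms ball_simps) simp
qed

lemma ideal_power_image:
  assumes J: "ideal_of F J" and NJ: "N \<subseteq> J"
  shows "ideal_power Q (proj ` J) n = proj ` (prod_mod N J ^^ (n - 1)) J"
proof -
  have "(ideal_prod Q (proj ` J) ^^ k) (proj ` J) = proj ` (prod_mod N J ^^ k) J" for k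
    by (induction k) (auto simp: ideal_prod_image[OF J ideal_funpow_prod_mod[OF J NJ]])
  then show ?thesis
    by (simp add: ideal_power_def)
qed

theorem powers_of_nongraded_ideal:
  assumes I: "two_sided_ideal Q I" and nongraded: "\<not> graded_ideal Q component I"
  shows "0 < m \<Longrightarrow> m < n \<Longrightarrow> ideal_power Q I m \<noteq> ideal_power Q I n"
    and "two_sided_ideal Q (ideal_power Q I n)"
    and "\<not> graded_ideal Q component (ideal_power Q I n)"
proof -
  define J where "J = preimage I"
  have J: "ideal_of F J" and NJ: "N \<subseteq> J" and IJ: "I = proj ` J"
    using ideal_preimage[OF I] subset_preimage[OF I] image_preimage[OF I] by (simp_all add: J_def)
  have J': "\<not> J \<subseteq> graded_part J"
    using nongraded graded_ideal_image_iff[OF J NJ] by (simp add: IJ)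
  note K = ideal_funpow_prod_mod[OF J NJ] subset_funpow_prod_mod[OF J NJ]
  show "ideal_power Q I m \<noteq> ideal_power Q I n" if "0 < m" "m < n"
  proof
    assume "ideal_power Q I m = ideal_power Q I n"
    then have "preimage (proj ` (prod_mod N J ^^ (m - 1)) J) = preimage (proj ` (prod_mod N J ^^ (n - 1)) J)"
      by (simp add: IJ ideal_power_image[OF J NJ])
    then have "(prod_mod N J ^^ (m - 1)) J = (prod_mod N J ^^ (n - 1)) J"
      by (simp add: preimage_image[OF K])
    then show False
      \<comment> \<open>The power with exponent \<open>m\<close> is the iterate number
        \<open>m - 1\<close>. As \<open>0 < m\<close>, the truncated subtraction preserves
        \<open>m < n\<close>.\<close>
      using funpow_prod_mod_strict[OF J NJ, of "m - 1" "n - 1"] J' that by linarith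
  qed
  show "two_sided_ideal Q (ideal_power Q I n)"
    unfolding IJ ideal_power_image[OF J NJ] by (rule two_sided_ideal_image[OF K])
  show "\<not> graded_ideal Q component (ideal_power Q I n)"
    unfolding IJ ideal_power_image[OF J NJ] graded_ideal_image_iff[OF K]
    using graded_funpow_prod_mod_imp_graded[OF J NJ] J' by blast
qed

end


section \<open>Regularity of Leavitt path algebras\<close>

lemma sum_single_keys: "(\<Sum>w\<in>Poly_Mapping.keys p. Poly_Mapping.single w (Poly_Mapping.lookup p w)) = p"
  by (rule poly_mapping_eqI)
    (auto simp: lookup_sum lookup_single when_def sum.delta not_in_keys_iff_lookup_eq_zero)

lift_definition degree_part :: "('a \<Rightarrow> int) \<Rightarrow> int \<Rightarrow> ('a \<Rightarrow>\<^sub>0 'b::zero) \<Rightarrow> ('a \<Rightarrow>\<^sub>0 'b)"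
  is "\<lambda>d n f w. if d w = n then f w else 0"
  by (rule finite_subset) auto

lemma lookup_degree_part: "Poly_Mapping.lookup (degree_part d n p) w = (if d w = n then Poly_Mapping.lookup p w else 0)"
  by transfer simp

lemma keys_degree_part: "Poly_Mapping.keys (degree_part d n p) = {w \<in> Poly_Mapping.keys p. d w = n}"
  by (auto simp: in_keys_iff lookup_degree_part split: if_splits)

lemma degree_part_eq_iff: "degree_part d n p = p \<longleftrightarrow> (\<forall>w\<in>Poly_Mapping.keys p. d w = n)"
  by (metis (mono_tags, lifting) in_keys_iff keys_degree_part lookup_degree_part mem_Collect_eq
      poly_mapping_eqI)

lemma degree_part_single:
  "degree_part d n (Poly_Mapping.single w c) = (if d w = n then Poly_Mapping.single w c else 0)"
  by (rule poly_mapping_eqI) (auto simp: lookup_degree_part lookup_single when_def)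

lemma degree_part_add: "degree_part d n (p + q) = degree_part d n p + degree_part d n q"
  by (rule poly_mapping_eqI) (auto simp: lookup_degree_part lookup_add)

lemma degree_part_zero [simp]: "degree_part d n 0 = 0"
  by (rule poly_mapping_eqI) (auto simp: lookup_degree_part)

lemma degree_part_sum: "degree_part d n (sum f A) = (\<Sum>i\<in>A. degree_part d n (f i))"
  by (induction A rule: infinite_finite_induct) (auto simp: degree_part_add)

lemma degree_part_degree_part:
  "degree_part d m (degree_part d n p) = (if m = n then degree_part d n p else 0)"
  by (rule poly_mapping_eqI) (auto simp: lookup_degree_part)

lemma finite_degree_part: "finite {n. degree_part d n p \<noteq> 0}"
proof (rule finite_subset)
  show "{n. degree_part d n p \<noteq> 0} \<subseteq> d ` Poly_Mapping.keys p"
    using keys_degree_part[of d _ p] by (auto simp flip: keys_eq_empty)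
qed simp

lemma sum_degree_part: "(\<Sum>n | degree_part d n p \<noteq> 0. degree_part d n p) = p"
proof (rule poly_mapping_eqI)
  fix w
  have "degree_part d (d w) p = 0 \<Longrightarrow> Poly_Mapping.lookup p w = 0"
    using lookup_degree_part[of d "d w" p w] by simp
  then show "Poly_Mapping.lookup (\<Sum>n | degree_part d n p \<noteq> 0. degree_part d n p) w = Poly_Mapping.lookup p w"
    using finite_degree_part[of d p] by (auto simp: lookup_sum lookup_degree_part sum.delta)
qed

lemma degree_part_single_mult:
  fixes q :: "'a::monoid_add \<Rightarrow>\<^sub>0 'b::ring"
  assumes "\<And>u v. d (u + v) = d u + d v"
  shows "degree_part d n (Poly_Mapping.single u c * q) =
    Poly_Mapping.single u c * degree_part d (n - d u) q"
proof -
  have "degree_part d n (Poly_Mapping.single u c * Poly_Mapping.single w b) =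
      Poly_Mapping.single u c * degree_part d (n - d u) (Poly_Mapping.single w b)" for w b
    by (auto simp: mult_single degree_part_single assms)
  then have "degree_part d n (Poly_Mapping.single u c *
        (\<Sum>w\<in>Poly_Mapping.keys q. Poly_Mapping.single w (Poly_Mapping.lookup q w))) =
      Poly_Mapping.single u c * degree_part d (n - d u)
        (\<Sum>w\<in>Poly_Mapping.keys q. Poly_Mapping.single w (Poly_Mapping.lookup q w))"
    by (simp only: sum_distrib_left degree_part_sum)
  then show ?thesis
    by (simp only: sum_single_keys)
qed

lemma degree_part_mult:
  fixes p q :: "'a::monoid_add \<Rightarrow>\<^sub>0 'b::ring"
  assumes "\<And>u v. d (u + v) = d u + d v"
  shows "degree_part d n (degree_part d m p * q) = degree_part d m p * degree_part d (n - m) q"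
proof -
  let ?p = "degree_part d m p"
  have "degree_part d n ((\<Sum>w\<in>Poly_Mapping.keys ?p. Poly_Mapping.single w (Poly_Mapping.lookup ?p w)) * q) =
      (\<Sum>w\<in>Poly_Mapping.keys ?p. Poly_Mapping.single w (Poly_Mapping.lookup ?p w)) * degree_part d (n - m) q"
    unfolding sum_distrib_right degree_part_sum
    by (rule sum.cong) (auto simp: degree_part_single_mult assms keys_degree_part)
  then show ?thesis
    by (simp only: sum_single_keys)
qed

lemma word_degree_plus: "word_degree (u + v) = word_degree u + word_degree v"
  by (simp add: word_degree_def plus_word_def)

interpretation graded_free: graded_ring "carrier (free_algebra X)" "degree_part word_degree" for X
proof (unfold_locales, rule ideal_of_carrier_free_algebra)
qed (auto simp: free_algebra_def keys_degree_part degree_part_add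
      finite_degree_part sum_degree_part degree_part_degree_part degree_part_mult word_degree_plus)

abbreviation scalar :: "'k \<Rightarrow> 'a word \<Rightarrow>\<^sub>0 'k::field" where
  "scalar c \<equiv> Poly_Mapping.single 0 c"

text \<open>Scalars are supported on the empty word, so they are central although words do not
  commute.\<close>

lemma scalar_commute: "p * scalar c = scalar c * p"
proof -
  have "(\<Sum>w\<in>Poly_Mapping.keys p. Poly_Mapping.single w (Poly_Mapping.lookup p w)) * scalar c =
      scalar c * (\<Sum>w\<in>Poly_Mapping.keys p. Poly_Mapping.single w (Poly_Mapping.lookup p w))"
    unfolding sum_distrib_left sum_distrib_right
    by (rule sum.cong) (auto simp: mult_single mult.commute)
  then show ?thesis
    by (simp only: sum_single_keys)
qed

lemma scalar_mult_carrier: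
  "p \<in> carrier (free_algebra X) \<Longrightarrow> scalar c * p \<in> carrier (free_algebra X)"
  by (fastforce simp: free_algebra_def elim!: keys_word_mult split: if_splits)

lemma gen_homogeneous: "degree_part word_degree (gen_degree x) (gen x) = gen x"
  by (simp add: gen_def degree_part_single word_degree_def)

text \<open>All words in a relator have the same degree. This is what makes
  \<open>lpa_ideal E\<close> a graded ideal.\<close>

lemma lpa_relators_homogeneous:
  assumes "r \<in> lpa_relators E"
  shows "\<exists>n. degree_part word_degree n r = (r :: ('v, 'e, 'k::field) lpa_free)"
proof -
  have gen: "degree_part word_degree n (gen x :: ('v, 'e, 'k::field) lpa_free) = gen x"
    if "gen_degree x = n" for x n
    using gen_homogeneous[of x] that by simp
  have mult: "degree_part word_degree n (gen x * gen y :: ('v, 'e, 'k::field) lpa_free) = gen x * gen y"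
    if "gen_degree x + gen_degree y = n" for x y n
    using graded_free.homogeneous_mult[OF gen_homogeneous gen_homogeneous, of x y] that by simp
  have hom: "degree_part word_degree n (p - q) = p - q"
    if "degree_part word_degree n p = p" "degree_part word_degree n q = q"
    for n and p q :: "('v, 'e, 'k::field) lpa_free"
    using that by (simp add: graded_free.cmp_diff)
  from assms show ?thesis
  proof cases
    case (regular v)
    have "degree_part word_degree 0 r = r"
      unfolding regular(1) by (intro hom gen) (auto simp: degree_part_sum mult intro!: sum.cong)
    then show ?thesis ..
  qed (force intro!: hom gen mult)+
qed

lemma gen_carrier: "x \<in> X \<Longrightarrow> gen x \<in> carrier (free_algebra X)"
  by (simp add: free_algebra_def gen_def zero_word_def)

lemma (in wf_digraph) lpa_relators_carrier:
  "lpa_relators G \<subseteq> carrier (free_algebra (lpa_gens G))"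
proof
  let ?F = "carrier (free_algebra (lpa_gens G))"
  note FD = ideal_ofD[OF ideal_of_carrier_free_algebra[of "lpa_gens G"]]
  have gen: "v \<in> verts G \<Longrightarrow> gen (Vertex v) \<in> ?F" "e \<in> arcs G \<Longrightarrow> gen (Edge e) \<in> ?F"
    "e \<in> arcs G \<Longrightarrow> gen (Ghost e) \<in> ?F" for v e
    by (auto intro!: gen_carrier simp: lpa_gens_def)
  fix r :: "('a, 'b, 'k::field) lpa_free"
  assume "r \<in> lpa_relators G"
  then show "r \<in> ?F"
  proof cases
    case (regular v)
    have "(\<Sum>e\<in>out_arcs G v. gen (Edge e) * gen (Ghost e)) \<in> ?F"
      by (rule ideal_of_sum[OF ideal_of_carrier_free_algebra]) (auto intro!: FD(6) gen)
    with regular show ?thesis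
      by (auto simp: regular_vertex_def intro!: FD(3) gen)
  qed (auto intro!: FD(3,6) gen tail_in_verts head_in_verts)
qed

text \<open>\<open>N\<close> is a parameter with a defining equation so that the field type
  \<open>'k\<close> is fixed throughout the locale.\<close>

locale leavitt = wf_digraph E for E :: "('v, 'e) pre_digraph" +
  fixes N :: "('v, 'e, 'k::field) lpa_free set"
  assumes N_eq: "N = lpa_ideal E"
begin

abbreviation X where "X \<equiv> lpa_gens E"

abbreviation FA where "FA \<equiv> (carrier (free_algebra X) :: ('v, 'e, 'k) lpa_free set)"

lemmas FD = ideal_ofD[OF ideal_of_carrier_free_algebra[of X]]

lemma N_minimal:
  assumes "ideal_of FA J" "\<And>c p. p \<in> J \<Longrightarrow> scalar c * p \<in> J" "lpa_relators E \<subseteq> J"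
  shows "N \<subseteq> J"
  unfolding N_eq lpa_ideal_def generated_ideal_def two_sided_ideal_free_algebra_iff
  using assms by (intro Inter_lower) (simp add: free_algebra_def)

lemma
  shows ideal_N: "ideal_of FA N"
    and scalar_N: "p \<in> N \<Longrightarrow> scalar c * p \<in> N"
    and relators_N: "lpa_relators E \<subseteq> N"
proof -
  let ?C = "{J. ideal_of FA J \<and> (\<forall>c. \<forall>p\<in>J. scalar c * p \<in> J) \<and> lpa_relators E \<subseteq> J}"
  have N: "N = \<Inter>?C"
    by (simp add: N_eq lpa_ideal_def generated_ideal_def two_sided_ideal_free_algebra_iff)
      (simp add: free_algebra_def)
  have "FA \<in> ?C"
    using lpa_relators_carrier by (auto simp: ideal_of_carrier_free_algebra intro: scalar_mult_carrier)
  then have "\<Inter>?C \<subseteq> FA"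
    by (rule Inter_lower)
  then show "ideal_of FA N"
    unfolding N ideal_of_def[of FA "\<Inter>?C"] by (auto intro: ideal_ofD)
  show "p \<in> N \<Longrightarrow> scalar c * p \<in> N" "lpa_relators E \<subseteq> N"
    unfolding N by blast+
qed

lemmas ND = ideal_ofD[OF ideal_N]

text \<open>The graded part of \<open>N\<close> is an ideal closed under scalars, and it contains
  the homogeneous relators, so minimality of \<open>N\<close> applies to it.\<close>

lemma graded_N: "N \<subseteq> graded_free.graded_part N"
proof (rule N_minimal)
  show "ideal_of FA (graded_free.graded_part N)"
    by (rule graded_free.ideal_graded_part[OF ideal_N])
  show "scalar c * p \<in> graded_free.graded_part N" if "p \<in> graded_free.graded_part N" for c p
    using that scalar_N
    by (simp add: graded_free.graded_part_def degree_part_single_mult word_degree_plus)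
  show "lpa_relators E \<subseteq> graded_free.graded_part N"
  proof
    fix r :: "('v, 'e, 'k) lpa_free"
    assume r: "r \<in> lpa_relators E"
    then obtain n where "degree_part word_degree n r = r"
      using lpa_relators_homogeneous by blast
    then show "r \<in> graded_free.graded_part N"
      using graded_free.homogeneous_in_graded_part[OF ideal_N] r relators_N by blast
  qed
qed

section \<open>Words modulo the defining relations\<close>

definition word_elem :: "('v, 'e) lpa_gen list \<Rightarrow> ('v, 'e, 'k) lpa_free" where
  "word_elem w = Poly_Mapping.single (Word w) 1"

lemma word_elem_append: "word_elem (u @ w) = word_elem u * word_elem w"
  by (simp add: word_elem_def mult_single plus_word_def)

lemma word_elem_Nil: "word_elem [] = 1"
  by (simp add: word_elem_def flip: zero_word_def single_one)

lemma gen_eq_word_elem: "gen x = word_elem [x]"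
  by (simp add: gen_def word_elem_def)

lemma word_elem_F: "w \<noteq> [] \<Longrightarrow> set w \<subseteq> X \<Longrightarrow> word_elem w \<in> FA"
  by (auto simp: word_elem_def free_algebra_def zero_word_def)

text \<open>The empty word is allowed. It gives \<open>1\<close>, which lies outside
  \<open>FA\<close>, so the ideal property alone does not cover this case.\<close>

lemma word_elem_mult_N: "p \<in> N \<Longrightarrow> set w \<subseteq> X \<Longrightarrow> word_elem w * p \<in> N"
  by (cases "w = []") (auto simp: word_elem_Nil intro!: ND(6) word_elem_F)

lemma N_mult_word_elem: "p \<in> N \<Longrightarrow> set w \<subseteq> X \<Longrightarrow> p * word_elem w \<in> N"
  by (cases "w = []") (auto simp: word_elem_Nil intro!: ND(7) word_elem_F)

definition weq :: "('v, 'e) lpa_gen list \<Rightarrow> ('v, 'e) lpa_gen list \<Rightarrow> bool" (infix "\<approx>" 50) where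
  "u \<approx> w \<longleftrightarrow> word_elem u - word_elem w \<in> N"

definition null where "null w \<longleftrightarrow> word_elem w \<in> N"

lemma weq_refl [simp]: "u \<approx> u"
  using ND(2) by (simp add: weq_def)

lemma weq_sym: "u \<approx> w \<Longrightarrow> w \<approx> u"
  using ND(4)[of "word_elem u - word_elem w"] by (simp add: weq_def)

lemma weq_trans [trans]: "u \<approx> v \<Longrightarrow> v \<approx> w \<Longrightarrow> u \<approx> w"
  using ND(5)[of "word_elem u - word_elem v" "word_elem v - word_elem w"] by (simp add: weq_def)

lemma null_weq [trans]: "u \<approx> w \<Longrightarrow> null w \<Longrightarrow> null u"
  using ND(5)[of "word_elem u - word_elem w" "word_elem w"] by (simp add: weq_def null_def)

lemma weq_context:
  assumes "u \<approx> w" "set a \<subseteq> X" "set b \<subseteq> X"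
  shows "a @ u @ b \<approx> a @ w @ b"
proof -
  have "word_elem (a @ u @ b) - word_elem (a @ w @ b) = word_elem a * ((word_elem u - word_elem w) * word_elem b)"
    by (simp add: word_elem_append algebra_simps)
  then show ?thesis
    using assms by (simp add: weq_def word_elem_mult_N N_mult_word_elem)
qed

lemma null_context: "null u \<Longrightarrow> set a \<subseteq> X \<Longrightarrow> set b \<subseteq> X \<Longrightarrow> null (a @ u @ b)"
  by (simp add: null_def word_elem_append word_elem_mult_N N_mult_word_elem)

lemma gens [simp]: "v \<in> verts E \<Longrightarrow> Vertex v \<in> X" "e \<in> arcs E \<Longrightarrow> Edge e \<in> X" "e \<in> arcs E \<Longrightarrow> Ghost e \<in> X"
  by (auto simp: lpa_gens_def)

lemma relator_weq: "word_elem u - word_elem w \<in> lpa_relators E \<Longrightarrow> u \<approx> w"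
  using relators_N by (auto simp: weq_def)

lemma relator_null: "word_elem u \<in> lpa_relators E \<Longrightarrow> null u"
  using relators_N by (auto simp: null_def)

lemma relations:
  assumes "e \<in> arcs E"
  shows "[Vertex (tail E e), Edge e] \<approx> [Edge e]" "[Edge e, Vertex (head E e)] \<approx> [Edge e]"
    "[Vertex (head E e), Ghost e] \<approx> [Ghost e]" "[Ghost e, Vertex (tail E e)] \<approx> [Ghost e]"
    "[Ghost e, Edge e] \<approx> [Vertex (head E e)]"
    "f \<in> arcs E \<Longrightarrow> e \<noteq> f \<Longrightarrow> null [Ghost e, Edge f]"
  using lpa_relators.intros(3-8)[where ?'k='k, OF assms] word_elem_append[of "[x]" "[y]" for x y]
  by (auto intro!: relator_weq relator_null simp: gen_eq_word_elem)

lemma vertex_relations: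
  assumes "v \<in> verts E"
  shows "[Vertex v, Vertex v] \<approx> [Vertex v]"
    "w \<in> verts E \<Longrightarrow> v \<noteq> w \<Longrightarrow> null [Vertex v, Vertex w]"
  using lpa_relators.intros(1,2)[where ?'k='k, OF assms] word_elem_append[of "[x]" "[y]" for x y]
  by (auto intro!: relator_weq relator_null simp: gen_eq_word_elem)

text \<open>This is \<open>p q^*\<close> with the common range \<open>v\<close> written in the
  middle, so that empty paths, i.e. vertices, are no special case. The ghosts are reversed as the
  involution reverses products.\<close>

definition path_word :: "'e list \<Rightarrow> 'v \<Rightarrow> 'e list \<Rightarrow> ('v, 'e) lpa_gen list" where
  "path_word p v q = map Edge p @ [Vertex v] @ map Ghost (rev q)"

lemma awalk_gens: "awalk u p v \<Longrightarrow> Edge ` set p \<subseteq> X \<and> Ghost ` set p \<subseteq> X \<and> Vertex v \<in> X \<and> Vertex u \<in> X"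
  using awalk_last_in_verts[of u p v] by (auto simp: awalk_def)

lemma path_word_gens: "awalk u p v \<Longrightarrow> awalk u' q v \<Longrightarrow> set (path_word p v q) \<subseteq> X"
  using awalk_gens[of u p v] awalk_gens[of u' q v] by (auto simp: path_word_def)

lemma vertex_path:
  assumes "awalk u p v" "set b \<subseteq> X"
  shows "Vertex u # map Edge p @ [Vertex v] @ b \<approx> map Edge p @ [Vertex v] @ b"
proof (cases p)
  case Nil
  then have "[] @ [Vertex u, Vertex v] @ b \<approx> [] @ [Vertex v] @ b"
    using assms vertex_relations(1)[of u] by (intro weq_context) (auto simp: awalk_simps)
  then show ?thesis
    using Nil by simp
next
  case (Cons e es)
  then have "[] @ [Vertex u, Edge e] @ (map Edge es @ [Vertex v] @ b) \<approx>
      [] @ [Edge e] @ (map Edge es @ [Vertex v] @ b)"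
    using assms relations(1)[of e] awalk_gens[of "head E e" es v]
    by (intro weq_context) (auto simp: awalk_simps)
  then show ?thesis
    using Cons by simp
qed

text \<open>Inserting the source \<open>u\<close> in front of \<open>p\<close> lets two distinct
  vertices meet.\<close>

lemma vertex_path_null:
  assumes "awalk u p v" "set b \<subseteq> X" "u' \<in> verts E" "u' \<noteq> u"
  shows "null (Vertex u' # map Edge p @ [Vertex v] @ b)"
proof -
  have "[Vertex u'] @ (map Edge p @ [Vertex v] @ b) @ [] \<approx>
      [Vertex u'] @ (Vertex u # map Edge p @ [Vertex v] @ b) @ []"
    by (rule weq_context[OF weq_sym[OF vertex_path[OF assms(1,2)]]]) (use assms in auto)
  also have "null ([] @ [Vertex u', Vertex u] @ (map Edge p @ [Vertex v] @ b))"
    by (intro null_context vertex_relations) (use assms awalk_gens[OF assms(1)] in auto)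
  then have "null ([Vertex u'] @ (Vertex u # map Edge p @ [Vertex v] @ b) @ [])"
    by simp
  finally show ?thesis
    by simp
qed

text \<open>The words that vanish or equal \<open>p q\<^sup>*\<close> for paths \<open>p\<close> and \<open>q\<close> of lengths \<open>a\<close> and \<open>b\<close>.\<close>

definition reduces :: "nat \<Rightarrow> nat \<Rightarrow> ('v, 'e) lpa_gen list \<Rightarrow> bool" where
  "reduces a b w \<longleftrightarrow> null w \<or>
     (\<exists>p v q u u'. awalk u p v \<and> awalk u' q v \<and> length p = a \<and> length q = b \<and> w \<approx> path_word p v q)"

lemma reducesI:
  assumes "w \<approx> path_word p v q" "awalk u p v" "awalk u' q v" "length p = a" "length q = b"
  shows "reduces a b w"
  using assms by (auto simp: reduces_def)

lemma reduces_weq: "w \<approx> w' \<Longrightarrow> reduces a b w' \<Longrightarrow> reduces a b w"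
  unfolding reduces_def by (blast intro: weq_trans null_weq)

lemma reduces_Cons_lift:
  assumes "reduces a b w" "x \<in> X"
    and "\<And>p v q u u'. awalk u p v \<Longrightarrow> awalk u' q v \<Longrightarrow> length p = a \<Longrightarrow> length q = b \<Longrightarrow>
      reduces a' b' (x # path_word p v q)"
  shows "reduces a' b' (x # w)"
proof -
  consider "null w" | p v q u u' where "awalk u p v" "awalk u' q v" "length p = a" "length q = b"
    "w \<approx> path_word p v q"
    using assms(1) by (auto simp: reduces_def)
  then show ?thesis
  proof cases
    case 1
    then have "null ([x] @ w @ [])"
      using assms(2) by (intro null_context) auto
    then show ?thesis
      by (simp add: reduces_def)
  next
    case 2
    have "[x] @ w @ [] \<approx> [x] @ path_word p v q @ []"
      by (rule weq_context) (use 2 assms(2) in auto)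
    then have "x # w \<approx> x # path_word p v q"
      by simp
    then show ?thesis
      using assms(3)[OF 2(1-4)] by (rule reduces_weq)
  qed
qed

lemma reduces_Vertex:
  assumes "reduces a b w" "y \<in> verts E"
  shows "reduces a b (Vertex y # w)"
proof (rule reduces_Cons_lift[OF assms(1)])
  fix p v q u u'
  assume pq: "awalk u p v" "awalk u' q v" "length p = a" "length q = b"
  have q: "set (map Ghost (rev q)) \<subseteq> X"
    using awalk_gens[OF pq(2)] by auto
  show "reduces a b (Vertex y # path_word p v q)"
  proof (cases "y = u")
    case True
    then show ?thesis
      using vertex_path[OF pq(1) q] pq by (intro reducesI) (auto simp: path_word_def)
  next
    case False
    then show ?thesis
      using vertex_path_null[OF pq(1) q assms(2)] by (simp add: reduces_def path_word_def)
  qed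
qed (use assms in auto)

lemma reduces_Edge:
  assumes "reduces a b w" "e \<in> arcs E"
  shows "reduces (Suc a) b (Edge e # w)"
proof (rule reduces_Cons_lift[OF assms(1)])
  fix p v q u u'
  assume pq: "awalk u p v" "awalk u' q v" "length p = a" "length q = b"
  have q: "set (map Ghost (rev q)) \<subseteq> X"
    using awalk_gens[OF pq(2)] by auto
  show "reduces (Suc a) b (Edge e # path_word p v q)"
  proof (cases "head E e = u")
    case True
    then have "awalk (tail E e) (e # p) v"
      using pq assms(2) by (simp add: awalk_simps)
    then show ?thesis
      using pq by (intro reducesI[of _ "e # p" v q]) (auto simp: path_word_def)
  next
    case False
    have "[] @ [Edge e] @ path_word p v q \<approx> [] @ [Edge e, Vertex (head E e)] @ path_word p v q"
      using relations(2)[OF assms(2)] path_word_gens[OF pq(1,2)]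
      by (intro weq_context[OF weq_sym]) auto
    moreover have "null ([Edge e] @ (Vertex (head E e) # path_word p v q) @ [])"
      using vertex_path_null[OF pq(1) q head_in_verts[OF assms(2)] False] assms(2)
      by (intro null_context) (auto simp: path_word_def)
    ultimately show ?thesis
      using null_weq by (fastforce simp: reduces_def)
  qed
qed (use assms in auto)

text \<open>The truncated differences cover two cases. For \<open>a > 0\<close> the ghost meets the
  first edge of \<open>p\<close> and cancels it or kills the word; for \<open>a = 0\<close> it
  lengthens \<open>q\<close> by one.\<close>

lemma reduces_Ghost:
  assumes "reduces a b w" "e \<in> arcs E"
  shows "reduces (a - 1) (b + (1 - a)) (Ghost e # w)"
proof (rule reduces_Cons_lift[OF assms(1)])
  fix p v q u u'
  assume pq: "awalk u p v" "awalk u' q v" "length p = a" "length q = b"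
  have q: "set (map Ghost (rev q)) \<subseteq> X"
    using awalk_gens[OF pq(2)] by auto
  show "reduces (a - 1) (b + (1 - a)) (Ghost e # path_word p v q)"
  proof (cases p)
    case Nil
    then have a: "a = 0" and v: "v \<in> verts E"
      using pq by (auto simp: awalk_simps)
    show ?thesis
    proof (cases "tail E e = v")
      case True
      have "[] @ [Ghost e, Vertex v] @ map Ghost (rev q) \<approx> [] @ [Ghost e] @ map Ghost (rev q)"
        using relations(4)[OF assms(2)] q True by (intro weq_context) auto
      also have "\<dots> \<approx> [] @ [Vertex (head E e), Ghost e] @ map Ghost (rev q)"
        using relations(3)[OF assms(2)] q by (intro weq_context[OF weq_sym]) auto
      finally have "Ghost e # path_word p v q \<approx> path_word [] (head E e) (q @ [e])"
        by (simp add: path_word_def Nil)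
      moreover have "awalk u' (q @ [e]) (head E e)"
        using pq(2) True assms(2) by (intro awalk_appendI) (auto simp: awalk_simps)
      ultimately show ?thesis
        using pq(4) assms(2) a
        by (intro reducesI[of _ "[]" "head E e" "q @ [e]" "head E e"]) (auto simp: awalk_simps)
    next
      case False
      have "[] @ [Ghost e] @ (Vertex v # map Ghost (rev q)) \<approx>
          [] @ [Ghost e, Vertex (tail E e)] @ (Vertex v # map Ghost (rev q))"
        using relations(4)[OF assms(2)] q v by (intro weq_context[OF weq_sym]) auto
      moreover have "null ([Ghost e] @ [Vertex (tail E e), Vertex v] @ map Ghost (rev q))"
        using vertex_relations(2)[of "tail E e" v] False v q assms(2) by (intro null_context) auto
      ultimately show ?thesis
        using null_weq by (fastforce simp: reduces_def path_word_def Nil)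
    qed
  next
    case (Cons f p')
    then have f: "f \<in> arcs E" "awalk (head E f) p' v" "length p' = a - 1" "1 - a = 0"
      using pq by (auto simp: awalk_simps)
    have rest: "set (map Edge p' @ [Vertex v] @ map Ghost (rev q)) \<subseteq> X"
      using awalk_gens[OF f(2)] q by auto
    show ?thesis
    proof (cases "e = f")
      case True
      have "[] @ [Ghost e, Edge f] @ (map Edge p' @ [Vertex v] @ map Ghost (rev q)) \<approx>
          [] @ [Vertex (head E f)] @ (map Edge p' @ [Vertex v] @ map Ghost (rev q))"
        unfolding True by (intro weq_context relations f rest) simp
      also have "\<dots> = Vertex (head E f) # map Edge p' @ [Vertex v] @ map Ghost (rev q)"
        by simp
      also have "\<dots> \<approx> path_word p' v q"
        unfolding path_word_def by (rule vertex_path[OF f(2) q])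
      finally show ?thesis
        using pq f by (intro reducesI[of _ p' v q]) (auto simp: path_word_def Cons)
    next
      case False
      have "null ([] @ [Ghost e, Edge f] @ (map Edge p' @ [Vertex v] @ map Ghost (rev q)))"
        using relations(6)[OF assms(2) f(1) False] rest by (intro null_context) auto
      then show ?thesis
        by (simp add: reduces_def path_word_def Cons)
    qed
  qed
qed (use assms in auto)

lemma reduces_Ghosts:
  assumes "reduces a b w" "set q \<subseteq> arcs E"
  shows "reduces (a - length q) (b + (length q - a)) (map Ghost q @ w)"
  using assms(2)
proof (induction q)
  case (Cons e q)
  then have *: "reduces (a - length q - 1) (b + (length q - a) + (1 - (a - length q))) (Ghost e # map Ghost q @ w)"
    by (intro reduces_Ghost) auto
  have **: "b + (length q - a) + (1 - (a - length q)) = b + (length (e # q) - a)"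
    by (cases "a \<le> length q") auto
  show ?case
    using *[unfolded **] by simp
qed (use assms(1) in simp)

lemma reduces_Edges:
  assumes "reduces a b w" "set p \<subseteq> arcs E"
  shows "reduces (length p + a) b (map Edge p @ w)"
  using assms(2) by (induction p) (auto intro: reduces_Edge assms(1))

text \<open>The shorter of the inner paths \<open>q\<close> and \<open>p'\<close> is absorbed by the
  longer one, and the excess goes to \<open>p\<close> or to \<open>q'\<close>. At most one of the
  truncated differences is nonzero.\<close>

lemma reduces_mult:
  assumes "awalk u p v" "awalk u' q v" "awalk z p' w" "awalk z' q' w"
  shows "reduces (length p + (length p' - length q)) (length q' + (length q - length p'))
    (path_word p v q @ path_word p' w q')"
proof -
  have "reduces (length p') (length q') (path_word p' w q')"
    by (rule reducesI[OF weq_refl assms(3,4)]) auto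
  then have "reduces (length p + (length p' - length (rev q))) (length q' + (length (rev q) - length p'))
      (map Edge p @ (Vertex v # (map Ghost (rev q) @ path_word p' w q')))"
    using assms by (intro reduces_Edges reduces_Vertex reduces_Ghosts) (auto simp: awalk_def awalk_last_in_verts[OF assms(1)])
  then show ?thesis
    by (simp add: path_word_def)
qed

text \<open>The induction starts with single letters, since the empty word is not of the form
  \<open>path_word\<close>. Each further letter on the left changes \<open>a - b\<close> by its
  degree.\<close>

lemma reduces_word:
  assumes "w \<noteq> []" "set w \<subseteq> X"
  shows "\<exists>a b. reduces a b w \<and> int a - int b = word_degree (Word w)"
  using assms
proof (induction w)
  case (Cons x w)
  show ?case
  proof (cases "w = []")
    case True
    have x: "x \<in> X"
      using Cons.prems by simp
    have refl: "awalk v [] v" if "v \<in> verts E" for v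
      using that by (simp add: awalk_simps)
    show ?thesis
    proof (cases x)
      case (Vertex v)
      then have "reduces 0 0 [x]"
        using x by (intro reducesI[of _ "[]" v "[]"] refl) (auto simp: path_word_def lpa_gens_def intro: refl)
      then show ?thesis
        using True Vertex by (auto simp: word_degree_def intro!: exI[of _ 0])
    next
      case (Edge e)
      then have e: "e \<in> arcs E"
        using x by (auto simp: lpa_gens_def)
      have "reduces 1 0 [x]"
        using weq_sym[OF relations(2)[OF e]] e Edge
        by (intro reducesI[of _ "[e]" "head E e" "[]" "tail E e" "head E e"]) (auto simp: path_word_def awalk_simps)
      then show ?thesis
        using True Edge by (intro exI[of _ 1] exI[of _ 0]) (auto simp: word_degree_def)
    next
      case (Ghost e)
      then have e: "e \<in> arcs E"
        using x by (auto simp: lpa_gens_def)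
      have "reduces 0 1 [x]"
        using weq_sym[OF relations(3)[OF e]] e Ghost
        by (intro reducesI[of _ "[]" "head E e" "[e]" "head E e" "tail E e"]) (auto simp: path_word_def awalk_simps)
      then show ?thesis
        using True Ghost by (intro exI[of _ 0] exI[of _ 1]) (auto simp: word_degree_def)
    qed
  next
    case False
    then obtain a b where ab: "reduces a b w" "int a - int b = word_degree (Word w)"
      using Cons by auto
    have deg: "word_degree (Word (x # w)) = gen_degree x + (int a - int b)"
      using ab(2) by (simp add: word_degree_def)
    show ?thesis
    proof (cases x)
      case (Vertex v)
      then show ?thesis
        using reduces_Vertex[OF ab(1), of v] Cons.prems deg by (auto simp: lpa_gens_def)
    next
      case (Edge e)
      then have "reduces (Suc a) b (x # w)"
        using reduces_Edge[OF ab(1), of e] Cons.prems by (auto simp: lpa_gens_def)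
      moreover have "int (Suc a) - int b = word_degree (Word (x # w))"
        using deg Edge by simp
      ultimately show ?thesis
        by blast
    next
      case (Ghost e)
      then have "reduces (a - 1) (b + (1 - a)) (x # w)"
        using reduces_Ghost[OF ab(1), of e] Cons.prems by (auto simp: lpa_gens_def)
      moreover have "int (a - 1) - int (b + (1 - a)) = word_degree (Word (x # w))"
        using deg Ghost by (cases a) auto
      ultimately show ?thesis
        by blast
    qed
  qed
qed simp

text \<open>Cancellation of \<open>e^* f\<close> proceeds from the middle outwards. For empty paths
  the only difference can be that between \<open>v\<close> and \<open>w\<close>.\<close>

lemma ghosts_edges:
  assumes "length q = length p" "awalk u q v" "awalk z p w"
  shows "if q = p \<and> v = w
    then Vertex v # map Ghost (rev q) @ map Edge p @ [Vertex w] \<approx> [Vertex v]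
    else null (Vertex v # map Ghost (rev q) @ map Edge p @ [Vertex w])"
  using assms
proof (induction q p arbitrary: u z rule: list_induct2)
  case Nil
  then show ?case
    using vertex_relations[of v] by (auto simp: awalk_simps)
next
  case (Cons e q f p)
  have e: "e \<in> arcs E" "awalk (head E e) q v" and f: "f \<in> arcs E" "awalk (head E f) p w"
    using Cons.prems by (auto simp: awalk_simps)
  have left: "set (Vertex v # map Ghost (rev q)) \<subseteq> X"
    using awalk_gens[OF e(2)] by auto
  have right: "set (map Edge p @ [Vertex w]) \<subseteq> X"
    using awalk_gens[OF f(2)] by auto
  let ?w = "Vertex v # map Ghost (rev (e # q)) @ map Edge (f # p) @ [Vertex w]"
  have w: "?w = (Vertex v # map Ghost (rev q)) @ [Ghost e, Edge f] @ (map Edge p @ [Vertex w])"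
    by simp
  show ?case
  proof (cases "e = f")
    case True
    have "?w \<approx> (Vertex v # map Ghost (rev q)) @ [Vertex (head E f)] @ (map Edge p @ [Vertex w])"
      unfolding w using weq_context[OF relations(5)[OF f(1)] left right] True by (simp only:)
    also have "\<dots> = (Vertex v # map Ghost (rev q)) @ (Vertex (head E f) # map Edge p @ [Vertex w] @ []) @ []"
      by simp
    also have "\<dots> \<approx> (Vertex v # map Ghost (rev q)) @ (map Edge p @ [Vertex w] @ []) @ []"
      by (rule weq_context[OF vertex_path[OF f(2)] left]) auto
    finally have "?w \<approx> Vertex v # map Ghost (rev q) @ map Edge p @ [Vertex w]"
      by simp
    then show ?thesis
      using Cons.IH[OF e(2) f(2)] weq_trans null_weq True by (auto split: if_splits)
  next
    case False
    then have "null ?w"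
      unfolding w by (intro null_context relations e f left right)
    then show ?thesis
      using False by simp
  qed
qed

text \<open>The multiplication rule of matrix units, for inner paths of equal length.\<close>

lemma path_word_mult:
  assumes "awalk u p v" "awalk u' q v" "awalk z p' w" "awalk z' q' w" "length q = length p'"
  shows "if q = p' \<and> v = w then path_word p v q @ path_word p' w q' \<approx> path_word p v q'
    else null (path_word p v q @ path_word p' w q')"
proof -
  let ?m = "Vertex v # map Ghost (rev q) @ map Edge p' @ [Vertex w]"
  have w: "path_word p v q @ path_word p' w q' = map Edge p @ ?m @ map Ghost (rev q')"
    by (simp add: path_word_def)
  have left: "set (map Edge p) \<subseteq> X" and right: "set (map Ghost (rev q')) \<subseteq> X"
    using awalk_gens[OF assms(1)] awalk_gens[OF assms(4)] by auto
  show ?thesis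
  proof (cases "q = p' \<and> v = w")
    case True
    then have "?m \<approx> [Vertex v]"
      using ghosts_edges[OF assms(5,2,3)] by simp
    then have "path_word p v q @ path_word p' w q' \<approx> path_word p v q'"
      unfolding w unfolding path_word_def by (rule weq_context[OF _ left right])
    with True show ?thesis
      by simp
  next
    case False
    then have "null ?m"
      using ghosts_edges[OF assms(5,2,3)] by (auto split: if_splits)
    then have "null (path_word p v q @ path_word p' w q')"
      unfolding w by (rule null_context[OF _ left right])
    with False show ?thesis
      by auto
  qed
qed

text \<open>Combinations, modulo \<open>N\<close>, of the \<open>p q\<^sup>*\<close> with \<open>(|p|, |q|) = (i + s, j + s)\<close> for some \<open>s \<in> Z\<close>.\<close>

inductive_set path_span :: "nat \<Rightarrow> nat \<Rightarrow> nat set \<Rightarrow> ('v, 'e, 'k) lpa_free set"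
  for i j Z where
    base: "x \<in> N \<Longrightarrow> x \<in> path_span i j Z"
  | step: "x \<in> path_span i j Z \<Longrightarrow> s \<in> Z \<Longrightarrow> awalk u p v \<Longrightarrow> awalk u' q v \<Longrightarrow>
      length p = i + s \<Longrightarrow> length q = j + s \<Longrightarrow>
      scalar c * word_elem (path_word p v q) + x \<in> path_span i j Z"

lemma path_span_mono: "x \<in> path_span i j Y \<Longrightarrow> Y \<subseteq> Z \<Longrightarrow> x \<in> path_span i j Z"
  by (induction rule: path_span.induct) (auto intro: path_span.intros)

lemma path_span_add:
  assumes "x \<in> path_span i j Z" "y \<in> path_span i j Z"
  shows "x + y \<in> path_span i j Z"
  using assms(1)
proof (induction rule: path_span.induct)
  case (base x)
  from assms(2) show ?case
  proof (induction rule: path_span.induct)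
    case (base y)
    then show ?case
      using \<open>x \<in> N\<close> by (auto intro: path_span.base ND(5))
  next
    case (step y s u p v u' q c)
    then show ?case
      using path_span.step[OF step(7,2-6), of c] by (simp add: add_ac)
  qed
next
  case (step x s u p v u' q c)
  then show ?case
    using path_span.step[OF step(7,2-6), of c] by (simp add: add_ac)
qed

lemma scalar_mult_scalar: "scalar c * (scalar d * x) = scalar (c * d) * x"
  by (simp add: mult_single flip: mult.assoc)

lemma path_span_scalar: "x \<in> path_span i j Z \<Longrightarrow> scalar c * x \<in> path_span i j Z"
proof (induction rule: path_span.induct)
  case (step x s u p v u' q d)
  then show ?case
    using path_span.step[OF step(7,2-6), of "c * d"]
    by (simp add: distrib_left scalar_mult_scalar)
qed (auto intro: path_span.base scalar_N)

lemma path_span_uminus: "x \<in> path_span i j Z \<Longrightarrow> - x \<in> path_span i j Z"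
  using path_span_scalar[of x i j Z "- 1"] by (simp add: single_uminus)

lemma path_span_diff:
  "x \<in> path_span i j Z \<Longrightarrow> y \<in> path_span i j Z \<Longrightarrow> x - y \<in> path_span i j Z"
  using path_span_add[of x i j Z "- y"] path_span_uminus[of y] by simp

lemma path_span_sum: "(\<And>x. x \<in> A \<Longrightarrow> f x \<in> path_span i j Z) \<Longrightarrow> sum f A \<in> path_span i j Z"
  by (induction A rule: infinite_finite_induct) (auto intro: path_span_add path_span.base ND(2))

lemma path_span_F: "x \<in> path_span i j Z \<Longrightarrow> x \<in> FA"
proof (induction rule: path_span.induct)
  case (step x s u p v u' q c)
  have "path_word p v q \<noteq> []"
    by (simp add: path_word_def)
  then show ?case
    using step path_word_gens[OF step(3,4)] by (intro FD(5) scalar_mult_carrier word_elem_F)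
qed (rule ND(1))

lemma reduces_path_span:
  assumes "reduces (i + s) (j + s) w" "s \<in> Z"
  shows "scalar c * word_elem w \<in> path_span i j Z"
proof -
  consider "null w" | p v q u u' where "awalk u p v" "awalk u' q v" "length p = i + s" "length q = j + s"
    "w \<approx> path_word p v q"
    using assms(1) by (auto simp: reduces_def)
  then show ?thesis
  proof cases
    case 1
    then show ?thesis
      by (auto simp: null_def intro: path_span.base scalar_N)
  next
    case 2
    have "scalar c * word_elem w =
        scalar c * word_elem (path_word p v q) + scalar c * (word_elem w - word_elem (path_word p v q))"
      by (simp add: algebra_simps)
    also have "\<dots> \<in> path_span i j Z"
      using 2 assms(2) by (intro path_span.step path_span.base scalar_N) (auto simp: weq_def)
    finally show ?thesis .
  qed
qed

text \<open>The inner paths have lengths \<open>j + s\<close> and \<open>j + t\<close>. By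
  \<open>reduces_mult\<close> the shorter is absorbed, which leaves a term with shift
  \<open>max s t\<close>.\<close>

lemma path_span_mult:
  assumes a: "a \<in> path_span i j Y" and b: "b \<in> path_span j k Z"
    and W: "\<And>y z. y \<in> Y \<Longrightarrow> z \<in> Z \<Longrightarrow> max y z \<in> W"
  shows "a * b \<in> path_span i k W"
  using a
proof (induction rule: path_span.induct)
  case (base x)
  then show ?case
    using path_span_F[OF b] by (auto intro: path_span.base ND)
next
  case (step x s u p v u' q c)
  let ?m = "word_elem (path_word p v q)"
  have mF: "?m \<in> FA"
    using path_word_gens[OF step(3,4)] by (intro word_elem_F) (auto simp: path_word_def)
  have "?m * b \<in> path_span i k W"
    using b
  proof (induction rule: path_span.induct)
    case (base y)
    then show ?case
      using mF by (auto intro: path_span.base ND)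
  next
    case (step y t z p' w z' q' d)
    have "?m * word_elem (path_word p' w q') = word_elem (path_word p v q @ path_word p' w q')"
      by (simp add: word_elem_append)
    moreover have "reduces (i + max s t) (k + max s t) (path_word p v q @ path_word p' w q')"
    proof -
      have "length p + (length p' - length q) = i + max s t"
        "length q' + (length q - length p') = k + max s t"
        using step(5,6) \<open>length p = i + s\<close> \<open>length q = j + s\<close> by (cases "s \<le> t"; simp)+
      then show ?thesis
        using reduces_mult[OF \<open>awalk u p v\<close> \<open>awalk u' q v\<close> step(3,4)] by simp
    qed
    ultimately have "scalar d * (?m * word_elem (path_word p' w q')) \<in> path_span i k W"
      using reduces_path_span[OF _ W[OF \<open>s \<in> Y\<close> \<open>t \<in> Z\<close>]] by simp
    moreover have "?m * (scalar d * word_elem (path_word p' w q')) = scalar d * (?m * word_elem (path_word p' w q'))"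
      by (simp only: scalar_commute[of ?m d] flip: mult.assoc)
    ultimately show ?case
      using step.IH by (simp add: distrib_left path_span_add)
  qed
  then have "scalar c * (?m * b) + x * b \<in> path_span i k W"
    using step.IH by (intro path_span_add path_span_scalar)
  then show ?case
    by (simp add: distrib_right mult.assoc)
qed

lemma path_span_mult_le:
  assumes "a \<in> path_span i j {..<t}" "b \<in> path_span j k {..<t}"
  shows "a * b \<in> path_span i k {..<t}"
  by (rule path_span_mult[OF assms]) auto

text \<open>A quasi-inverse \<open>x\<close> of \<open>a - a y a\<close> gives the quasi-inverse
  \<open>y + (1 - y a) x (1 - a y)\<close> of \<open>a\<close>, expanded here because the ring need
  not have a unit.\<close>

lemma quasi_inverse_step:
  fixes a x y :: "'a::ring"
  defines "b \<equiv> a - a * y * a"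
  shows "a - a * (y + x - y * a * x - x * a * y + y * a * x * a * y) * a = b - b * x * b"
  by (simp add: b_def algebra_simps)

section \<open>Matrix units and elimination of rows\<close>

definition paths where "paths n = {(p, v). length p = n \<and> (\<exists>u. awalk u p v)}"

text \<open>The matrix unit \<open>p q^*\<close>, meaningful for \<open>snd P = snd Q\<close>. The
  range belongs to the index because an empty path does not determine it.\<close>

definition path_unit :: "'e list \<times> 'v \<Rightarrow> 'e list \<times> 'v \<Rightarrow> ('v, 'e, 'k) lpa_free" where
  "path_unit P Q = word_elem (path_word (fst P) (snd P) (fst Q))"

lemma path_unit_F: "P \<in> paths m \<Longrightarrow> Q \<in> paths n \<Longrightarrow> snd P = snd Q \<Longrightarrow> path_unit P Q \<in> FA"
  unfolding path_unit_def paths_def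
  by (intro word_elem_F) (auto dest: subsetD[OF path_word_gens], simp add: path_word_def)

lemma path_unit_mult:
  assumes "P \<in> paths l" "Q \<in> paths m" "snd P = snd Q" "P' \<in> paths m" "Q' \<in> paths n" "snd P' = snd Q'"
  shows "path_unit P Q * path_unit P' Q' - (if Q = P' then path_unit P Q' else 0) \<in> N"
proof -
  obtain p v q p' w q' where eq: "P = (p, v)" "Q = (q, v)" "P' = (p', w)" "Q' = (q', w)"
    using assms(3,6) by (metis prod.collapse)
  then show ?thesis
    using assms path_word_mult[of _ p v _ q _ p' w _ q'] unfolding eq paths_def path_unit_def
    by (auto simp: word_elem_append null_def weq_def split: if_splits)
qed

lemma diff_trans_N: "a - b \<in> N \<Longrightarrow> b - c \<in> N \<Longrightarrow> a - c \<in> N"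
  using ND(5)[of "a - b" "b - c"] by simp

lemma sum_diff_N: "(\<And>i. i \<in> A \<Longrightarrow> f i - g i \<in> N) \<Longrightarrow> sum f A - sum g A \<in> N"
  unfolding sum_subtractf[symmetric] by (rule ideal_of_sum[OF ideal_N])

definition matrix where
  "matrix R C c = (\<Sum>P\<in>R. \<Sum>Q\<in>C. scalar (c P Q) * path_unit P Q)"

lemma path_unit_path_span:
  assumes "P \<in> paths (i + s)" "Q \<in> paths (j + s)" "snd P = snd Q"
  shows "scalar c * path_unit P Q \<in> path_span i j {s}"
  using assms path_span.step[OF path_span.base[OF ND(2)], of s "{s}" _ "fst P" "snd P" _ "fst Q" i j c]
  by (auto simp: paths_def path_unit_def)

text \<open>The coefficients vanish outside \<open>R\<close> and \<open>C\<close>, so enlarging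
  these sets by the paths of a new term does not change the old sum.\<close>

lemma path_span_matrix:
  assumes "a \<in> path_span i j {s}"
  shows "\<exists>R C c. finite R \<and> finite C \<and> R \<subseteq> paths (i + s) \<and> C \<subseteq> paths (j + s) \<and>
    (\<forall>P Q. c P Q \<noteq> 0 \<longrightarrow> P \<in> R \<and> Q \<in> C \<and> snd P = snd Q) \<and> a - matrix R C c \<in> N"
  using assms
proof (induction rule: path_span.induct)
  case (base x)
  then show ?case
    by (intro exI[of _ "{}"] exI[of _ "\<lambda>_ _. 0"]) (auto simp: matrix_def)
next
  case (step x t u p v u' q d)
  then obtain R C c where IH: "finite R" "finite C" "R \<subseteq> paths (i + s)" "C \<subseteq> paths (j + s)"
    "\<forall>P Q. c P Q \<noteq> 0 \<longrightarrow> P \<in> R \<and> Q \<in> C \<and> snd P = snd Q" "x - matrix R C c \<in> N"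
    by blast
  let ?P = "(p, v)" and ?Q = "(q, v)"
  let ?R = "insert ?P R" and ?C = "insert ?Q C"
  let ?d = "\<lambda>P Q. if P = ?P \<and> Q = ?Q then d else 0"
  let ?c = "\<lambda>P Q. ?d P Q + c P Q"
  have "matrix ?R ?C ?c = matrix ?R ?C ?d + matrix ?R ?C c"
    by (simp add: matrix_def single_add distrib_right sum.distrib)
  also have "matrix ?R ?C ?d = (\<Sum>P\<in>?R. if P = ?P then \<Sum>Q\<in>?C. if Q = ?Q then scalar d * path_unit P Q else 0 else 0)"
    unfolding matrix_def by (intro sum.cong refl) (auto intro!: sum.cong sum.neutral)
  also have "\<dots> = scalar d * path_unit ?P ?Q"
    using IH(1,2) by (simp add: sum.delta del: sum.insert)
  also have "matrix ?R ?C c = matrix R C c"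
  proof -
    have zero: "c P Q = 0" if "P \<notin> R \<or> Q \<notin> C" for P Q
      using IH(5) that by blast
    have "matrix R C c = (\<Sum>P\<in>R. \<Sum>Q\<in>?C. scalar (c P Q) * path_unit P Q)"
      unfolding matrix_def
      by (rule sum.cong[OF refl], rule sum.mono_neutral_left) (use IH(2) zero in auto)
    also have "\<dots> = matrix ?R ?C c"
      unfolding matrix_def using IH(1) zero
      by (intro sum.mono_neutral_left) (auto intro!: sum.neutral)
    finally show ?thesis ..
  qed
  finally have "scalar d * word_elem (path_word p v q) + x - matrix ?R ?C ?c \<in> N"
    using IH(6) by (simp add: path_unit_def algebra_simps)
  moreover have "?R \<subseteq> paths (i + s)" "?C \<subseteq> paths (j + s)"
    using IH(3,4) step.hyps by (auto simp: paths_def)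
  moreover have "\<forall>P Q. ?c P Q \<noteq> 0 \<longrightarrow> P \<in> ?R \<and> Q \<in> ?C \<and> snd P = snd Q"
    using IH(5) by (auto split: if_splits)
  moreover have "finite ?R" "finite ?C"
    using IH(1,2) by simp_all
  ultimately show ?case
    by (intro exI conjI)
qed

context
  fixes R C :: "('e list \<times> 'v) set" and m n :: nat and c :: "'e list \<times> 'v \<Rightarrow> 'e list \<times> 'v \<Rightarrow> 'k"
  assumes fin: "finite R" "finite C" and R: "R \<subseteq> paths m" and C: "C \<subseteq> paths n"
    and c: "\<And>P Q. c P Q \<noteq> 0 \<Longrightarrow> P \<in> R \<and> Q \<in> C \<and> snd P = snd Q"
begin

text \<open>Right multiplication by a matrix unit moves column \<open>Q0\<close> to position
  \<open>P0\<close> and deletes the other columns.\<close>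

lemma matrix_mult_path_unit:
  assumes Q0: "Q0 \<in> C" and P0: "P0 \<in> paths l" "snd Q0 = snd P0"
  shows "matrix R C c * path_unit Q0 P0 - (\<Sum>P\<in>R. scalar (c P Q0) * path_unit P P0) \<in> N"
  unfolding matrix_def sum_distrib_right
proof (rule sum_diff_N)
  fix P assume "P \<in> R"
  have "(\<Sum>Q\<in>C. scalar (c P Q) * path_unit P Q * path_unit Q0 P0) -
      (\<Sum>Q\<in>C. scalar (c P Q) * (if Q = Q0 then path_unit P P0 else 0)) \<in> N"
  proof (rule sum_diff_N)
    fix Q
    show "scalar (c P Q) * path_unit P Q * path_unit Q0 P0 -
      scalar (c P Q) * (if Q = Q0 then path_unit P P0 else 0) \<in> N"
    proof (cases "c P Q = 0")
      case False
      then have "path_unit P Q * path_unit Q0 P0 - (if Q = Q0 then path_unit P P0 else 0) \<in> N"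
        using c[OF False] R C Q0 P0 by (intro path_unit_mult) auto
      then have "scalar (c P Q) * (path_unit P Q * path_unit Q0 P0 - (if Q = Q0 then path_unit P P0 else 0)) \<in> N"
        by (rule scalar_N)
      then show ?thesis
        by (simp only: right_diff_distrib mult.assoc)
    qed (simp add: ND(2))
  qed
  also have "(\<Sum>Q\<in>C. scalar (c P Q) * (if Q = Q0 then path_unit P P0 else 0)) =
      (\<Sum>Q\<in>C. if Q = Q0 then scalar (c P Q0) * path_unit P P0 else 0)"
    by (rule sum.cong) auto
  also have "\<dots> = scalar (c P Q0) * path_unit P P0"
    using fin(2) Q0 by (simp add: sum.delta)
  finally show "(\<Sum>Q\<in>C. scalar (c P Q) * path_unit P Q * path_unit Q0 P0) -
      scalar (c P Q0) * path_unit P P0 \<in> N" .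
qed

lemma path_unit_mult_matrix:
  assumes P0: "P0 \<in> R" and P: "P \<in> paths l" "snd P = snd P0"
  shows "path_unit P P0 * matrix R C c - (\<Sum>Q\<in>C. scalar (c P0 Q) * path_unit P Q) \<in> N"
  unfolding matrix_def sum_distrib_left sum.swap[of _ C R]
proof (rule sum_diff_N)
  fix Q assume "Q \<in> C"
  have "(\<Sum>P'\<in>R. path_unit P P0 * (scalar (c P' Q) * path_unit P' Q)) -
      (\<Sum>P'\<in>R. scalar (c P' Q) * (if P0 = P' then path_unit P Q else 0)) \<in> N"
  proof (rule sum_diff_N)
    fix P'
    show "path_unit P P0 * (scalar (c P' Q) * path_unit P' Q) -
      scalar (c P' Q) * (if P0 = P' then path_unit P Q else 0) \<in> N"
    proof (cases "c P' Q = 0")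
      case False
      then have "path_unit P P0 * path_unit P' Q - (if P0 = P' then path_unit P Q else 0) \<in> N"
        using c[OF False] R C P0 P by (intro path_unit_mult) auto
      then have "scalar (c P' Q) * (path_unit P P0 * path_unit P' Q - (if P0 = P' then path_unit P Q else 0)) \<in> N"
        by (rule scalar_N)
      moreover have "path_unit P P0 * (scalar (c P' Q) * path_unit P' Q) =
          scalar (c P' Q) * (path_unit P P0 * path_unit P' Q)"
        by (simp only: scalar_commute[of "path_unit P P0"] flip: mult.assoc)
      ultimately show ?thesis
        by (simp only: right_diff_distrib)
    qed (simp add: ND(2))
  qed
  also have "(\<Sum>P'\<in>R. scalar (c P' Q) * (if P0 = P' then path_unit P Q else 0)) =
      (\<Sum>P'\<in>R. if P0 = P' then scalar (c P0 Q) * path_unit P Q else 0)"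
    by (rule sum.cong) auto
  also have "\<dots> = scalar (c P0 Q) * path_unit P Q"
    using fin(1) P0 by (simp add: sum.delta')
  finally show "(\<Sum>P'\<in>R. path_unit P P0 * (scalar (c P' Q) * path_unit P' Q)) -
      scalar (c P0 Q) * path_unit P Q \<in> N" .
qed

lemma matrix_F: "matrix R C c \<in> FA"
  unfolding matrix_def
proof (intro ideal_of_sum[OF ideal_of_carrier_free_algebra])
  show "scalar (c P Q) * path_unit P Q \<in> FA" for P Q
  proof (cases "c P Q = 0")
    case False
    then show ?thesis
      using c[OF False] R C by (intro scalar_mult_carrier path_unit_F[of _ m _ n]) auto
  qed (simp add: FD(2))
qed

text \<open>The result is column \<open>Q0\<close> times row \<open>P0\<close>, a matrix of rank at
  most one.\<close>

lemma matrix_mult_path_unit_mult_matrix: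
  assumes Q0: "Q0 \<in> C" and P0: "P0 \<in> R" and QP: "snd Q0 = snd P0"
  shows "matrix R C c * path_unit Q0 P0 * matrix R C c -
    (\<Sum>P\<in>R. \<Sum>Q\<in>C. scalar (c P Q0 * c P0 Q) * path_unit P Q) \<in> N"
proof (rule diff_trans_N)
  have "(matrix R C c * path_unit Q0 P0 - (\<Sum>P\<in>R. scalar (c P Q0) * path_unit P P0)) * matrix R C c \<in> N"
    using P0 R by (intro ND(7) matrix_F matrix_mult_path_unit Q0 QP) auto
  then show "matrix R C c * path_unit Q0 P0 * matrix R C c -
      (\<Sum>P\<in>R. scalar (c P Q0) * path_unit P P0) * matrix R C c \<in> N"
    by (simp only: left_diff_distrib)
  show "(\<Sum>P\<in>R. scalar (c P Q0) * path_unit P P0) * matrix R C c -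
      (\<Sum>P\<in>R. \<Sum>Q\<in>C. scalar (c P Q0 * c P0 Q) * path_unit P Q) \<in> N"
    unfolding sum_distrib_right
  proof (rule sum_diff_N)
    fix P assume "P \<in> R"
    show "scalar (c P Q0) * path_unit P P0 * matrix R C c -
      (\<Sum>Q\<in>C. scalar (c P Q0 * c P0 Q) * path_unit P Q) \<in> N"
    proof (cases "c P Q0 = 0")
      case False
      have "scalar (c P Q0) *
          (path_unit P P0 * matrix R C c - (\<Sum>Q\<in>C. scalar (c P0 Q) * path_unit P Q)) \<in> N"
        using c[OF False] R \<open>P \<in> R\<close> QP
        by (intro scalar_N path_unit_mult_matrix[OF P0, of _ m]) auto
      then show ?thesis
        by (simp only: right_diff_distrib sum_distrib_left scalar_mult_scalar mult.assoc)
    qed (simp add: ND(2))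
  qed
qed

end

text \<open>Gaussian elimination by induction on the number of nonzero rows. For a pivot
  \<open>c P0 Q0\<close> let \<open>y\<close> be the transposed matrix unit divided by the pivot.
  Subtracting \<open>m y m\<close> from the matrix \<open>m\<close> then clears row
  \<open>P0\<close>, and \<open>quasi_inverse_step\<close> leads back to \<open>m\<close>.\<close>

lemma matrix_quasi_inverse:
  assumes "finite R" "finite C" "R \<subseteq> paths (i + s)" "C \<subseteq> paths (j + s)"
    "\<And>P Q. c P Q \<noteq> 0 \<Longrightarrow> P \<in> R \<and> Q \<in> C \<and> snd P = snd Q"
  shows "\<exists>x\<in>path_span j i {s}. matrix R C c - matrix R C c * x * matrix R C c \<in> N"
  using assms(5)
proof (induction "card {P. \<exists>Q. c P Q \<noteq> 0}" arbitrary: c rule: less_induct)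
  case less
  note prems = assms(1-4) less.prems
  let ?m = "matrix R C c"
  show ?case
  proof (cases "\<exists>P Q. c P Q \<noteq> 0")
    case False
    then have "c P Q = 0" for P Q
      by blast
    then have "?m = 0"
      by (simp add: matrix_def)
    then show ?thesis
      by (intro bexI[of _ 0]) (auto intro: path_span.base ND(2))
  next
    case True
    then obtain P0 Q0 where c0: "c P0 Q0 \<noteq> 0"
      by blast
    then have PQ: "P0 \<in> R" "Q0 \<in> C" "snd Q0 = snd P0"
      using less.prems by auto
    define c' where "c' P Q = c P Q - c P Q0 * c P0 Q / c P0 Q0" for P Q
    define y where "y = scalar (1 / c P0 Q0) * path_unit Q0 P0"
    have y: "y \<in> path_span j i {s}"
      unfolding y_def using PQ assms(3,4) by (intro path_unit_path_span) auto
    let ?S = "\<Sum>P\<in>R. \<Sum>Q\<in>C. scalar (c P Q0 * c P0 Q) * path_unit P Q"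
    have "?m * y * ?m = scalar (1 / c P0 Q0) * (?m * path_unit Q0 P0 * ?m)"
      unfolding y_def by (simp only: scalar_commute[of ?m] flip: mult.assoc)
    moreover have "matrix R C c' = ?m - scalar (1 / c P0 Q0) * ?S"
      by (simp add: c'_def matrix_def single_diff left_diff_distrib sum_subtractf sum_distrib_left
          scalar_mult_scalar)
    ultimately have "matrix R C c' - (?m - ?m * y * ?m) =
        scalar (1 / c P0 Q0) * (?m * path_unit Q0 P0 * ?m - ?S)"
      by (simp add: algebra_simps)
    also have "\<dots> \<in> N"
      by (intro scalar_N matrix_mult_path_unit_mult_matrix[OF prems] PQ)
    finally have m': "matrix R C c' - (?m - ?m * y * ?m) \<in> N" .
    have c': "P \<in> R \<and> Q \<in> C \<and> snd P = snd Q" if "c' P Q \<noteq> 0" for P Q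
    proof (cases "c P Q = 0")
      case True
      then have "c P Q0 \<noteq> 0" "c P0 Q \<noteq> 0"
        using that by (auto simp: c'_def)
      then show ?thesis
        using less.prems[of P Q0] less.prems[of P0 Q] PQ by auto
    qed (use less.prems in auto)
    \<comment> \<open>Row \<open>P0\<close> is cleared, and a zero row \<open>P\<close> stays zero
      because its entry \<open>c P Q0\<close> is zero.\<close>
    have smaller: "{P. \<exists>Q. c' P Q \<noteq> 0} \<subset> {P. \<exists>Q. c P Q \<noteq> 0}"
    proof
      show "{P. \<exists>Q. c' P Q \<noteq> 0} \<subseteq> {P. \<exists>Q. c P Q \<noteq> 0}"
      proof
        fix P assume "P \<in> {P. \<exists>Q. c' P Q \<noteq> 0}"
        then obtain Q where "c' P Q \<noteq> 0"
          by blast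
        then have "c P Q \<noteq> 0 \<or> c P Q0 \<noteq> 0"
          by (auto simp: c'_def)
        then show "P \<in> {P. \<exists>Q. c P Q \<noteq> 0}"
          by blast
      qed
      have "P0 \<notin> {P. \<exists>Q. c' P Q \<noteq> 0}"
        using c0 by (simp add: c'_def)
      then show "{P. \<exists>Q. c' P Q \<noteq> 0} \<noteq> {P. \<exists>Q. c P Q \<noteq> 0}"
        using c0 by blast
    qed
    have "{P. \<exists>Q. c P Q \<noteq> 0} \<subseteq> R"
      using less.prems by blast
    then have "finite {P. \<exists>Q. c P Q \<noteq> 0}"
      using assms(1) by (rule finite_subset)
    from less.hyps[OF psubset_card_mono[OF this smaller] c'] obtain x where x: "x \<in> path_span j i {s}"
      "matrix R C c' - matrix R C c' * x * matrix R C c' \<in> N"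
      by blast
    \<comment> \<open>The reduced matrix equals \<open>b\<close> only modulo \<open>N\<close>. The
      error \<open>d\<close> is carried along to show that \<open>x\<close> is a quasi-inverse of
      \<open>b\<close> as well.\<close>
    define b where "b = ?m - ?m * y * ?m"
    define d where "d = matrix R C c' - b"
    have dN: "d \<in> N"
      using m' by (simp add: d_def b_def)
    have mF: "?m \<in> FA"
      by (rule matrix_F[OF prems])
    have bF: "b \<in> FA"
      unfolding b_def using path_span_F[OF y] mF by (intro FD(3,6))
    have xF: "x \<in> FA"
      by (rule path_span_F[OF x(1)])
    have m'b: "matrix R C c' = b + d"
      by (simp add: d_def)
    have "b - b * x * b = (matrix R C c' - matrix R C c' * x * matrix R C c') - d +
        (b * x * d + d * (x * b) + d * (x * d))"
      unfolding m'b by (simp add: algebra_simps)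
    also have "\<dots> \<in> N"
      by (rule ND(5)[OF ND(3)[OF x(2) dN] ND(5)[OF ND(5)]]) (intro ND(6,7) FD(6) bF xF dN ND(1)[OF dN])+
    finally have "b - b * x * b \<in> N" .
    then have "?m - ?m * (y + x - y * ?m * x - x * ?m * y + y * ?m * x * ?m * y) * ?m \<in> N"
      unfolding quasi_inverse_step b_def .
    moreover have "y + x - y * ?m * x - x * ?m * y + y * ?m * x * ?m * y \<in> path_span j i {s}"
    proof -
      have m: "?m \<in> path_span i j {s}"
        unfolding matrix_def
      proof -
        have "scalar (c P Q) * path_unit P Q \<in> path_span i j {s}" for P Q
        proof (cases "c P Q = 0")
          case False
          then show ?thesis
            using less.prems[OF False] assms(3,4) by (intro path_unit_path_span) auto
        qed (auto intro: path_span.base ND(2))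
        then show "(\<Sum>P\<in>R. \<Sum>Q\<in>C. scalar (c P Q) * path_unit P Q) \<in> path_span i j {s}"
          by (intro path_span_sum)
      qed
      have mult: "a * b \<in> path_span i' k {s}" if "a \<in> path_span i' j' {s}" "b \<in> path_span j' k {s}"
        for a b i' j' k
        by (rule path_span_mult[OF that]) auto
      have 1: "y * ?m \<in> path_span j j {s}" "x * ?m \<in> path_span j j {s}"
        by (rule mult[OF y m], rule mult[OF x(1) m])
      show ?thesis
        by (intro path_span_add path_span_diff y x mult[OF mult[OF mult[OF 1(1) x(1)] m] y]
            mult[OF 1(1) x(1)] mult[OF 1(2) y])
    qed
    ultimately show ?thesis
      by blast
  qed
qed

section \<open>Quasi-inverses of arbitrary homogeneous elements\<close>

lemma path_span_insert:
  assumes "a \<in> path_span i j (insert s Z)"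
  obtains x y where "x \<in> path_span i j Z" "y \<in> path_span i j {s}" "a = x + y"
proof -
  have "\<exists>x y. x \<in> path_span i j Z \<and> y \<in> path_span i j {s} \<and> a = x + y"
    using assms
  proof (induction rule: path_span.induct)
    case (base a)
    then show ?case
      by (intro exI[of _ a] exI[of _ 0]) (auto intro: path_span.base ND(2))
  next
    case (step a t u p v u' q c)
    then obtain x y where xy: "x \<in> path_span i j Z" "y \<in> path_span i j {s}" "a = x + y"
      by blast
    let ?w = "scalar c * word_elem (path_word p v q)"
    show ?case
    proof (cases "t = s")
      case True
      then have "?w + y \<in> path_span i j {s}"
        using step xy by (intro path_span.step) auto
      then show ?thesis
        using xy by (intro exI[of _ x] exI[of _ "?w + y"]) (auto simp: add_ac)
    next
      case False
      then have "?w + x \<in> path_span i j Z"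
        using step xy by (intro path_span.step) auto
      then show ?thesis
        using xy by (intro exI[of _ "?w + x"] exI[of _ y]) (auto simp: add_ac)
    qed
  qed
  then show ?thesis
    using that by blast
qed

lemma quasi_inverse_singleton:
  assumes a: "a \<in> path_span i j {s}"
  shows "\<exists>x\<in>path_span j i {s}. a - a * x * a \<in> N"
proof -
  obtain R C c where R: "finite R" "finite C" "R \<subseteq> paths (i + s)" "C \<subseteq> paths (j + s)"
    "\<forall>P Q. c P Q \<noteq> 0 \<longrightarrow> P \<in> R \<and> Q \<in> C \<and> snd P = snd Q" "a - matrix R C c \<in> N"
    using path_span_matrix[OF a] by (elim exE conjE)
  obtain x where x: "x \<in> path_span j i {s}" "matrix R C c - matrix R C c * x * matrix R C c \<in> N"
    using matrix_quasi_inverse[OF R(1-4), of c] R(5) by blast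
  define d where "d = a - matrix R C c"
  have d: "d \<in> N" "matrix R C c = a - d"
    using R(6) by (auto simp: d_def)
  have F: "a \<in> FA" "x \<in> FA" "d \<in> FA"
    using path_span_F[OF a] path_span_F[OF x(1)] ND(1)[OF d(1)] .
  have "a - a * x * a = (matrix R C c - matrix R C c * x * matrix R C c) + d -
      (a * x * d + d * (x * a) - d * (x * d))"
    unfolding d(2) by (simp add: algebra_simps)
  also have "\<dots> \<in> N"
    by (rule ND(3)[OF ND(5)[OF x(2) d(1)] ND(3)[OF ND(5)]]) (intro ND(6,7) FD(6) F d(1))+
  finally show ?thesis
    using x(1) by blast
qed

text \<open>Split \<open>a = b + m\<close> with \<open>m\<close> of the largest shift
  \<open>t\<close>, and let \<open>y\<close> be a quasi-inverse of \<open>b\<close>. In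
  \<open>a - a y a\<close> the part \<open>b - b y b\<close> is in \<open>N\<close> and every other
  term has a factor \<open>m\<close>. As products keep the larger shift, only the single shift
  \<open>t\<close> remains.\<close>

lemma quasi_inverse_lessThan:
  assumes "a \<in> path_span i j {..<t}"
  shows "\<exists>x\<in>path_span j i {..<t}. a - a * x * a \<in> N"
  using assms
proof (induction t arbitrary: a)
  case 0
  from 0 have "a \<in> N"
    by (induction rule: path_span.induct) auto
  then show ?case
    by (intro bexI[of _ 0]) (auto intro: path_span.base ND(2))
next
  case (Suc t)
  have up: "{..<t} \<subseteq> {..<Suc t}" "{t} \<subseteq> {..<Suc t}"
    by auto
  obtain b m where b: "b \<in> path_span i j {..<t}" and m: "m \<in> path_span i j {t}" and a: "a = b + m"
    using Suc.prems unfolding lessThan_Suc by (rule path_span_insert)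
  obtain y where y: "y \<in> path_span j i {..<t}" "b - b * y * b \<in> N"
    using Suc.IH[OF b] by blast
  have below: "p * q \<in> path_span i' k {t}"
    if "p \<in> path_span i' j' {..<t}" "q \<in> path_span j' k {t}" for p q i' j' k
    by (rule path_span_mult[OF that]) auto
  have above: "p * q \<in> path_span i' k {t}"
    if "p \<in> path_span i' j' {t}" "q \<in> path_span j' k {..<t}" for p q i' j' k
    by (rule path_span_mult[OF that]) auto
  have same: "p * q \<in> path_span i' k {t}"
    if "p \<in> path_span i' j' {t}" "q \<in> path_span j' k {t}" for p q i' j' k
    by (rule path_span_mult[OF that]) auto
  have "a - a * y * a = (b - b * y * b) + (m - b * (y * m) - m * y * b - m * y * m)"
    by (simp add: a algebra_simps)
  also have "\<dots> \<in> path_span i j {t}"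
    by (intro path_span_add path_span_diff path_span.base[OF y(2)] m below[OF b below[OF y(1) m]]
        above[OF above[OF m y(1)] b] same[OF above[OF m y(1)] m])
  finally obtain x where x: "x \<in> path_span j i {t}"
    "(a - a * y * a) - (a - a * y * a) * x * (a - a * y * a) \<in> N"
    using quasi_inverse_singleton by blast
  have a': "a \<in> path_span i j {..<Suc t}" and y': "y \<in> path_span j i {..<Suc t}"
    and x': "x \<in> path_span j i {..<Suc t}"
    using Suc.prems path_span_mono[OF y(1) up(1)] path_span_mono[OF x(1) up(2)] .
  note mult = path_span_mult_le[of _ _ _ "Suc t"]
  have ya: "y * a \<in> path_span j j {..<Suc t}" and xa: "x * a \<in> path_span j j {..<Suc t}"
    by (rule mult[OF y' a'], rule mult[OF x' a'])
  have "y + x - y * a * x - x * a * y + y * a * x * a * y \<in> path_span j i {..<Suc t}"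
    by (intro path_span_add path_span_diff y' x' mult[OF mult[OF mult[OF ya x'] a'] y']
        mult[OF ya x'] mult[OF xa y'])
  then show ?case
    using x(2) unfolding quasi_inverse_step[symmetric] by blast
qed

lemma path_span_UNIV:
  assumes "a \<in> path_span i j UNIV"
  shows "\<exists>t. a \<in> path_span i j {..<t}"
  using assms
proof (induction rule: path_span.induct)
  case (base x)
  then show ?case
    by (auto intro: path_span.base)
next
  case (step x s u p v u' q c)
  then obtain t where "x \<in> path_span i j {..<t}"
    by blast
  then have "x \<in> path_span i j {..<max t (Suc s)}"
    by (rule path_span_mono) auto
  then have "scalar c * word_elem (path_word p v q) + x \<in> path_span i j {..<max t (Suc s)}"
    using step by (intro path_span.step) auto
  then show ?case
    by blast
qed

text \<open>\<open>nat n\<close> and \<open>nat (- n)\<close> are the positive and negative parts of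
  \<open>n\<close>. Lengths \<open>k\<close> and \<open>l\<close> with difference \<open>n\<close>
  exceed them by the same amount, namely \<open>min k l\<close>.\<close>

lemma homogeneous_path_span:
  assumes a: "a \<in> FA" and hom: "degree_part word_degree n a = a"
  shows "a \<in> path_span (nat n) (nat (- n)) UNIV"
proof -
  have "Poly_Mapping.single w (Poly_Mapping.lookup a w) \<in> path_span (nat n) (nat (- n)) UNIV"
    if w: "w \<in> Poly_Mapping.keys a" for w
  proof -
    have wX: "letters w \<noteq> []" "set (letters w) \<subseteq> X"
      using a w by (cases w, auto simp: free_algebra_def zero_word_def)+
    have deg: "word_degree w = n"
      using hom w by (simp add: degree_part_eq_iff)
    obtain k l where kl: "reduces k l (letters w)" "int k - int l = n"
      using reduces_word[OF wX] deg by auto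
    define s where "s = min k l"
    have "k = nat n + s" "l = nat (- n) + s"
      using kl(2) by (auto simp: s_def)
    then have "scalar (Poly_Mapping.lookup a w) * word_elem (letters w) \<in> path_span (nat n) (nat (- n)) UNIV"
      using reduces_path_span[of "nat n" s "nat (- n)" "letters w" UNIV] kl(1) by simp
    then show ?thesis
      by (simp add: word_elem_def mult_single)
  qed
  then have "(\<Sum>w\<in>Poly_Mapping.keys a. Poly_Mapping.single w (Poly_Mapping.lookup a w)) \<in>
      path_span (nat n) (nat (- n)) UNIV"
    by (intro path_span_sum)
  then show ?thesis
    by (simp only: sum_single_keys)
qed

lemma homogeneous_regular:
  assumes "a \<in> FA" "degree_part word_degree n a = a"
  shows "\<exists>x\<in>FA. a - a * x * a \<in> N"
proof -
  obtain t where "a \<in> path_span (nat n) (nat (- n)) {..<t}"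
    using path_span_UNIV[OF homogeneous_path_span[OF assms]] by blast
  from quasi_inverse_lessThan[OF this] obtain x
    where "x \<in> path_span (nat (- n)) (nat n) {..<t}" "a - a * x * a \<in> N"
    by blast
  then show ?thesis
    using path_span_F by blast
qed

section \<open>The Leavitt path algebra as a graded quotient\<close>

sublocale graded_free_algebra_quotient X N "degree_part word_degree"
  by unfold_locales (use graded_N homogeneous_regular ideal_N in \<open>auto simp: graded_free.graded_part_def\<close>)

lemma component_eq: "component = lpa_component E"
  unfolding component_def lpa_component_def by (rule ext) (auto simp: degree_part_eq_iff N_eq)

end

theorem mainTheorem10:
  fixes E :: "('v, 'e) pre_digraph"
    and I :: "('v, 'e, 'k::field) lpa_free set set"
  assumes "wf_digraph E"
    and "non_graded_ideal E I"
  shows "(\<forall>m n. 0 < m \<and> m < n \<longrightarrow>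
            ideal_power (leavitt_path_algebra E) I m \<noteq> ideal_power (leavitt_path_algebra E) I n) \<and>
         (\<forall>n\<ge>1. non_graded_ideal E (ideal_power (leavitt_path_algebra E) I n))"
proof -
  interpret wf_digraph E
    by fact
  interpret leavitt E "lpa_ideal E :: ('v, 'e, 'k) lpa_free set"
    by unfold_locales simp
  have I: "two_sided_ideal Q I" "\<not> graded_ideal Q component I"
    using assms(2) by (simp_all only: non_graded_ideal_def leavitt_path_algebra_def component_eq simp_thms)
  show ?thesis
    using powers_of_nongraded_ideal[OF I]
    by (simp only: non_graded_ideal_def leavitt_path_algebra_def component_eq simp_thms)
      (intro conjI allI impI; blast?)
qed

end
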